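(* Let $n\ge 1$, let $\{\phi_\alpha\}_{\alpha\in A}$ be a regular family of cardinal interpolators on $\mathbb{R}^n$, and let $f\in\mathscr{F}W$, i.e. $\hat f\in L_\infty(\mathbb{R}^n)$ and $\sum_{j\in\mathbb{Z}^n}\|\hat f(\cdot+2\pi j)\|_{L_\infty([-\pi,\pi]^n)}<\infty$. Then $$\lim_{\alpha\to\infty}|f(x)-J_\alpha[f](x)|=0$$ uniformly in $x\in\mathbb{R}^n$.
   Context: Fourier transform: $\hat f(\xi)=(2\pi)^{-n/2}\int_{\mathbb{R}^n}f(x)e^{-i\langle x,\xi\rangle}\,dx$ for $f\in L^1(\mathbb{R}^n)$, extended to tempered distributions in the usual way. Space: $\mathscr{F}W=\{f:\hat f\in L_\infty(\mathbb{R}^n),\ \sum_{j\in\mathbb{Z}^n}\|\hat f(\cdot+2\pi j)\|_{L_\infty([-\pi,\pi]^n)}<\infty\}$. For such $f$ one has $\hat f\in L_1(\mathbb{R}^n)$, and $f$ is identified with its continuous representative given by Fourier inversion. Cardinal interpolator: a function $\phi$ on $\mathbb{R}^n$ such that (H1) $\phi$ is real valued and slowly increasing; (H2) $\hat\phi(\xi)\ge 0$, and $\hat\phi(\xi)\ge\delta>0$ on $[-\pi,\pi]^n$ for some $\delta$; (H3) $\hat\phi\in C^{n+1}(\mathbb{R}^n\setminus\{0\})$; (H4) there is $\epsilon>0$ such that for every multi-index $\beta$ with $|\beta|\le n+1$, $D^\beta\hat\phi(\xi)=O(\|\xi\|^{-(n+\epsilon)})$ as $\|\xi\|\to\infty$;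 (H5) for every multi-index $\beta$ with $|\beta|\le n+1$, $\dfrac{\prod_{j=1}^{|\beta|}D^{\beta_j}\hat\phi}{[\hat\phi]^{|\beta|+1}}\in L^\infty([-\pi,\pi]^n)$ whenever $\beta_1,\dots,\beta_{|\beta|}$ are multi-indices with $\sum_{j=1}^{|\beta|}\beta_j=\beta$. Regular family of cardinal interpolators: a family $\{\phi_\alpha\}_{\alpha\in A}$, with $A\subset(0,\infty)$ (unbounded, limits $\alpha\to\infty$ being taken along $A$), such that each $\phi_\alpha$ is a cardinal interpolator and, with $M_{j,\alpha}(\xi)=\hat\phi_\alpha(\xi+2\pi j)/\hat\phi_\alpha(\xi)$ for $j\in\mathbb{Z}^n\setminus\{0\}$, $\xi\in[-\pi,\pi]^n$: (R1) for each $j\ne0$, $\lim_{\alpha\to\infty}M_{j,\alpha}(\xi)=0$ for almost every $\xi\in[-\pi,\pi]^n$; (R2) there is a sequence $(M_j)\in\ell^1(\mathbb{Z}^n\setminus\{0\})$, independent of $\alpha$, with $M_{j,\alpha}(\xi)\le M_j$ for all $j\neq 0$ (all $\alpha\in A$, $\xi\in[-\pi,\pi]^n$). Fundamental function $L_\alpha$: defined by $\hat L_\alpha(\xi)=(2\pi)^{-n/2}\dfrac{\hat\phi_\alpha(\xi)}{\sum_{j\in\mathbb{Z}^n}\hat\phi_\alpha(\xi+2\pi j)}$ ($L_\alpha$ is taken to be continuous). Approximand: for $k\in\mathbb{Z}^n$ let $f_k$ be defined by $\hat f_k(\xi)=\hat f(\xi+2\pi k)\chi_{[-\pi,\pi]^n}(\xi)$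 (so $f_k$ is band-limited and has a continuous representative, which is used for the samples $f_k(j)$), and $$J_\alpha[f](x)=\sum_{j,k\in\mathbb{Z}^n}f_k(j)\,L_\alpha(x-j)\,e^{2\pi i\langle x,k\rangle}.$$ *)

theory Defs
  imports
    "HOL-Analysis.Analysis"
    "HOL-Library.Landau_Symbols"
    "HOL-Probability.Essential_Supremum"
begin

section \<open>Lattice, cube, multi-indices and partial derivatives\<close>

definition lat :: "int ^ 'n \<Rightarrow> real ^ 'n" where
  "lat j = (\<chi> i. real_of_int (j $ i))"

definition cube :: "(real ^ 'n) set" where
  "cube = {\<xi>. \<forall>i. - pi \<le> \<xi> $ i \<and> \<xi> $ i \<le> pi}"

definition mi_size :: "nat ^ 'n \<Rightarrow> nat" where
  "mi_size \<beta> = (\<Sum>i\<in>UNIV. \<beta> $ i)"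

definition pderiv_dir :: "'n \<Rightarrow> (real ^ 'n \<Rightarrow> 'b::real_normed_vector) \<Rightarrow> real ^ 'n \<Rightarrow> 'b" where
  "pderiv_dir i f x = frechet_derivative f (at x) (axis i 1)"

text \<open>The coordinate type carries no order, so one enumeration of the coordinates is fixed. It
  is immaterial on an open set where the function is \<open>|\<beta>|\<close> times continuously differentiable,
  which is the only situation in which \<open>mderiv \<beta>\<close> is used.\<close>

definition coords :: "'n::finite list" where
  "coords = (SOME is. distinct is \<and> set is = UNIV)"

definition mderiv :: "nat ^ 'n \<Rightarrow> (real ^ 'n \<Rightarrow> 'b::real_normed_vector) \<Rightarrow> real ^ 'n \<Rightarrow> 'b" where
  "mderiv \<beta> f = foldr (\<lambda>i. pderiv_dir i ^^ (\<beta> $ i)) coords f"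

text \<open>\<open>C_on k U f\<close>: \<open>f\<close> is of class \<open>C\<^sup>k\<close> on the open set \<open>U\<close>.\<close>

fun C_on :: "nat \<Rightarrow> (real ^ 'n) set \<Rightarrow> (real ^ 'n \<Rightarrow> 'b::real_normed_vector) \<Rightarrow> bool" where
  "C_on 0 U f \<longleftrightarrow> continuous_on U f"
| "C_on (Suc k) U f \<longleftrightarrow>
     (\<forall>x\<in>U. f differentiable (at x)) \<and> (\<forall>i. C_on k U (pderiv_dir i f))"


section \<open>Fourier transform of integrable functions and of tempered distributions\<close>

definition fourier :: "(real ^ 'n \<Rightarrow> complex) \<Rightarrow> real ^ 'n \<Rightarrow> complex" where
  "fourier f \<xi> = complex_of_real ((2 * pi) powr (- real CARD('n) / 2)) *
     (LINT x|lebesgue. f x * exp (- (\<i> * complex_of_real (x \<bullet> \<xi>))))"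

definition fourier_inv :: "(real ^ 'n \<Rightarrow> complex) \<Rightarrow> real ^ 'n \<Rightarrow> complex" where
  "fourier_inv g x = complex_of_real ((2 * pi) powr (- real CARD('n) / 2)) *
     (LINT \<xi>|lebesgue. g \<xi> * exp (\<i> * complex_of_real (x \<bullet> \<xi>)))"

definition schwartz :: "(real ^ 'n \<Rightarrow> complex) \<Rightarrow> bool" where
  "schwartz \<psi> \<longleftrightarrow> (\<forall>k. C_on k UNIV \<psi>) \<and>
     (\<forall>\<beta> N. \<exists>C. \<forall>x. (1 + norm x) ^ N * norm (mderiv \<beta> \<psi> x) \<le> C)"

definition slowly_increasing :: "(real ^ 'n \<Rightarrow> 'b::real_normed_vector) \<Rightarrow> bool" where
  "slowly_increasing f \<longleftrightarrow> f \<in> borel_measurable lebesgue \<and>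
     (\<exists>C N. \<forall>x. norm (f x) \<le> C * (1 + norm x) ^ N)"

text \<open>Distributions are treated as functionals on Schwartz functions. A slowly increasing
  function \<open>f\<close> is the tempered distribution \<open>distr_of f\<close>.\<close>

definition distr_of :: "(real ^ 'n \<Rightarrow> complex) \<Rightarrow> (real ^ 'n \<Rightarrow> complex) \<Rightarrow> complex" where
  "distr_of f \<psi> = (LINT x|lebesgue. f x * \<psi> x)"

definition fourier_distr ::
    "((real ^ 'n \<Rightarrow> complex) \<Rightarrow> complex) \<Rightarrow> (real ^ 'n \<Rightarrow> complex) \<Rightarrow> complex" where
  "fourier_distr T \<psi> = T (fourier \<psi>)"

text \<open>The distribution \<open>T\<close> is given on the open set \<open>U\<close> by the function \<open>g\<close>. The test functions
  are the Schwartz functions supported in \<open>U\<close>; for \<open>g\<close> bounded at infinity, and locally bounded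
  in \<open>U\<close>, this amounts to testing with compactly supported ones.\<close>

definition given_on ::
    "(real ^ 'n) set \<Rightarrow> ((real ^ 'n \<Rightarrow> complex) \<Rightarrow> complex) \<Rightarrow> (real ^ 'n \<Rightarrow> complex) \<Rightarrow> bool" where
  "given_on U T g \<longleftrightarrow>
     (\<forall>\<psi>. schwartz \<psi> \<and> closure {x. \<psi> x \<noteq> 0} \<subseteq> U \<longrightarrow>
        integrable lebesgue (\<lambda>x. g x * \<psi> x) \<and> T \<psi> = distr_of g \<psi>)"

definition Linf :: "'a measure \<Rightarrow> ('a \<Rightarrow> 'b::real_normed_vector) \<Rightarrow> bool" where
  "Linf M g \<longleftrightarrow> g \<in> borel_measurable M \<and> esssup M (\<lambda>x. ennreal (norm (g x))) < \<infinity>"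


section \<open>The space \<open>FW\<close>\<close>

text \<open>\<open>FW f F\<close>: \<open>f\<close> is the continuous representative of an element of the space, and \<open>F\<close> is a
  representative of its Fourier transform. (Such an \<open>f\<close> is bounded, so that requiring it to be
  slowly increasing only ensures that its distributional Fourier transform makes sense.)\<close>

definition FW :: "(real ^ 'n \<Rightarrow> complex) \<Rightarrow> (real ^ 'n \<Rightarrow> complex) \<Rightarrow> bool" where
  "FW f F \<longleftrightarrow>
     continuous_on UNIV f \<and> slowly_increasing f \<and>
     given_on UNIV (fourier_distr (distr_of f)) F \<and>
     Linf lebesgue F \<and>
     (\<Sum>\<^sub>\<infinity>j. esssup (lebesgue_on cube)
                (\<lambda>\<xi>. ennreal (norm (F (\<xi> + (2 * pi) *\<^sub>R lat j))))) < \<infinity>"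


section \<open>Cardinal interpolators\<close>

text \<open>\<open>\<Phi>\<close> is the Fourier transform of \<open>\<phi>\<close>. It may be singular at the origin (and need not be
  locally integrable there, as for multiquadrics), so it is a function on the complement of the
  origin only, and the value \<open>\<Phi> 0\<close> is arbitrary.\<close>

definition cardinal_interpolator :: "(real ^ 'n \<Rightarrow> real) \<Rightarrow> (real ^ 'n \<Rightarrow> real) \<Rightarrow> bool" where
  "cardinal_interpolator \<phi> \<Phi> \<longleftrightarrow>
     slowly_increasing \<phi> \<and>
     given_on (- {0}) (fourier_distr (distr_of (\<lambda>x. complex_of_real (\<phi> x))))
       (\<lambda>\<xi>. complex_of_real (\<Phi> \<xi>)) \<and>
     (\<forall>\<xi>. \<xi> \<noteq> 0 \<longrightarrow> \<Phi> \<xi> \<ge> 0) \<and>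
     (\<exists>\<delta>>0. \<forall>\<xi>\<in>cube - {0}. \<Phi> \<xi> \<ge> \<delta>) \<and>
     C_on (CARD('n) + 1) (- {0}) \<Phi> \<and>
     (\<exists>\<epsilon>>0. \<forall>\<beta>. mi_size \<beta> \<le> CARD('n) + 1 \<longrightarrow>
        mderiv \<beta> \<Phi> \<in> O[at_infinity](\<lambda>\<xi>. norm \<xi> powr (- (real CARD('n) + \<epsilon>)))) \<and>
     (\<forall>\<beta>. mi_size \<beta> \<le> CARD('n) + 1 \<longrightarrow>
        (\<forall>\<gamma> :: nat \<Rightarrow> nat ^ 'n. (\<Sum>i<mi_size \<beta>. \<gamma> i) = \<beta> \<longrightarrow>
           Linf (lebesgue_on cube)
             (\<lambda>\<xi>. (\<Prod>i<mi_size \<beta>. mderiv (\<gamma> i) \<Phi> \<xi>) / \<Phi> \<xi> ^ (mi_size \<beta> + 1))))"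

definition along :: "real set \<Rightarrow> real filter" where
  "along A = inf at_top (principal A)"

definition Mratio :: "(real ^ 'n \<Rightarrow> real) \<Rightarrow> int ^ 'n \<Rightarrow> real ^ 'n \<Rightarrow> real" where
  "Mratio \<Phi> j \<xi> = \<Phi> (\<xi> + (2 * pi) *\<^sub>R lat j) / \<Phi> \<xi>"

definition regular_family ::
    "real set \<Rightarrow> (real \<Rightarrow> real ^ 'n \<Rightarrow> real) \<Rightarrow> (real \<Rightarrow> real ^ 'n \<Rightarrow> real) \<Rightarrow> bool" where
  "regular_family A \<phi> \<Phi> \<longleftrightarrow>
     A \<subseteq> {0<..} \<and> \<not> bdd_above A \<and>
     (\<forall>\<alpha>\<in>A. cardinal_interpolator (\<phi> \<alpha>) (\<Phi> \<alpha>)) \<and>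
     (\<forall>j. j \<noteq> 0 \<longrightarrow>
        (AE \<xi> in lebesgue_on cube. ((\<lambda>\<alpha>. Mratio (\<Phi> \<alpha>) j \<xi>) \<longlongrightarrow> 0) (along A))) \<and>
     (\<exists>M :: int ^ 'n \<Rightarrow> real. (\<lambda>j. \<bar>M j\<bar>) summable_on (- {0}) \<and>
        (\<forall>j. j \<noteq> 0 \<longrightarrow> (\<forall>\<alpha>\<in>A. \<forall>\<xi>\<in>cube - {0}. Mratio (\<Phi> \<alpha>) j \<xi> \<le> M j)))"


section \<open>Fundamental functions and the approximand\<close>

text \<open>\<open>L\<close> and \<open>f\<^sub>k\<close> are prescribed through their (integrable) Fourier transforms; their continuous
  versions are the inverse Fourier integrals of these.\<close>

definition Lhat :: "(real ^ 'n \<Rightarrow> real) \<Rightarrow> real ^ 'n \<Rightarrow> real" where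
  "Lhat \<Phi> \<xi> = (2 * pi) powr (- real CARD('n) / 2) *
     (\<Phi> \<xi> / (\<Sum>\<^sub>\<infinity>j. \<Phi> (\<xi> + (2 * pi) *\<^sub>R lat j)))"

definition Lfun :: "(real ^ 'n \<Rightarrow> real) \<Rightarrow> real ^ 'n \<Rightarrow> complex" where
  "Lfun \<Phi> = fourier_inv (\<lambda>\<xi>. complex_of_real (Lhat \<Phi> \<xi>))"

definition band :: "(real ^ 'n \<Rightarrow> complex) \<Rightarrow> int ^ 'n \<Rightarrow> real ^ 'n \<Rightarrow> complex" where
  "band F k = fourier_inv (\<lambda>\<xi>. F (\<xi> + (2 * pi) *\<^sub>R lat k) * indicator cube \<xi>)"

definition Jterm ::
    "(real ^ 'n \<Rightarrow> real) \<Rightarrow> (real ^ 'n \<Rightarrow> complex) \<Rightarrow> real ^ 'n \<Rightarrow> (int ^ 'n) \<times> (int ^ 'n) \<Rightarrow> complex"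
  where
  "Jterm \<Phi> F x = (\<lambda>(j, k). band F k (lat j) * Lfun \<Phi> (x - lat j) *
     exp (2 * complex_of_real pi * \<i> * complex_of_real (x \<bullet> lat k)))"

definition J :: "(real ^ 'n \<Rightarrow> real) \<Rightarrow> (real ^ 'n \<Rightarrow> complex) \<Rightarrow> real ^ 'n \<Rightarrow> complex" where
  "J \<Phi> F x = (\<Sum>\<^sub>\<infinity>jk. Jterm \<Phi> F x jk)"

end

(* The Fourier transform of f is cut into its translates F_k = fhat (. + 2 pi k) over the cube; they are
   bounded with summable bounds, so fhat is integrable and f is its inverse Fourier integral, which is
   seen by testing the distributional Fourier transform with modulated Gaussians shrinking to a point.
   Folding the integral for L (x - j) over the cube turns it into the j-th Fourier coefficient of the
   bounded function P_x = c * (sum over m of w_m * cis (x . (xi + 2 pi m))), with c = (2 pi)^(-n/2),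
   where the w_m >= 0 are the translates of the Fourier transform of phi divided by their sum. Since the
   samples of f_k are Fourier coefficients of F_k, Bessel's inequality gives absolute convergence of the
   double series and Parseval's identity sums it over j to the integral of F_k * P_x. Hence f (x) - J (x)
   is a sum over k of integrals of F_k * (c * cis (x . xi) - P_x), and |c * cis (x . xi) - P_x| is at most
   2 c (1 - w_0). This bound does not depend on x, and the integral of 1 - w_0 over the cube tends to 0
   by (R1), (R2) and dominated convergence. *)

theory Submission
  imports Defs "HOL-Probability.Characteristic_Functions" "HOL-Real_Asymp.Real_Asymp"
begin

section \<open>Lattice tilings\<close>

text \<open>The proof works only with bounds for F_k and P_x on the cube, which make their Fourier
  coefficients square summable in j. Absolute convergence therefore has to come from Cauchy-Schwarz,
  and the sum over j from a pairing in L2 instead of a pointwise Fourier series. The factor exp (2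
  pi i x . k) in J is what makes the comparison possible: since cis (x . (xi + 2 pi k)) = cis (2 pi
  x . k) * cis (x . xi), the k-th piece of the inversion integral carries the same factor, and both
  pieces become integrals over one cube against the same F_k. The factor 2 in 2 c (1 - w_0) appears
  because the weights sum to 1: the term m = 0 misses its target by c (1 - w_0), and the other terms
  together weigh just as much. Two obstacles shape the details. The transform of phi may be singular
  at the origin and has an arbitrary value there, so pointwise statements are made off a null set.
  Dominated convergence is about sequences, while the limit runs along the set A, so the latter is
  reduced to sequences in A.\<close>

lemma integral_has_sum:
  fixes g :: "'j::countable \<Rightarrow> 'a \<Rightarrow> 'b::{banach,second_countable_topology}"
  assumes inf: "infinite (UNIV :: 'j set)"
    and g: "\<And>j. integrable M (g j)"
    and h: "h \<in> borel_measurable M"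
    and ae: "AE x in M. (\<lambda>j. norm (g j x)) summable_on UNIV \<and> ((\<lambda>j. g j x) has_sum h x) UNIV"
    and sm: "(\<lambda>j. \<integral>x. norm (g j x) \<partial>M) summable_on UNIV"
  shows "integrable M h" and "((\<lambda>j. \<integral>x. g j x \<partial>M) has_sum (\<integral>x. h x \<partial>M)) UNIV"
proof -
  \<comment> \<open>Since the index type is countably infinite, \<open>e\<close> is a bijection from
    the naturals. It turns unordered sums into series, for which termwise integration is available;
    absolute summability makes the order immaterial.\<close>
  define e :: "nat \<Rightarrow> 'j" where "e = from_nat_into UNIV"
  have e: "bij_betw e UNIV UNIV"
    unfolding e_def using inf by (intro bij_betw_from_nat_into) auto
  have r: "(\<lambda>n. u (e n)) summable_on UNIV \<longleftrightarrow> u summable_on UNIV" for u :: "'j \<Rightarrow> real"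
    by (rule summable_on_reindex_bij_betw[OF e])
  have ae': "AE x in M. summable (\<lambda>n. norm (g (e n) x)) \<and> (\<Sum>n. g (e n) x) = h x"
    using ae
  proof eventually_elim
    case (elim x)
    have "((\<lambda>n. g (e n) x) has_sum h x) UNIV"
      using elim has_sum_reindex_bij_betw[OF e, of "\<lambda>j. g j x" "h x"] by simp
    then have "(\<lambda>n. g (e n) x) sums h x" by (rule has_sum_imp_sums)
    moreover have "(\<lambda>n. norm (g (e n) x)) summable_on UNIV" using elim r[of "\<lambda>j. norm (g j x)"] by simp
    ultimately show ?case by (auto simp: sums_iff intro: summable_on_imp_summable)
  qed
  have sm': "summable (\<lambda>n. \<integral>x. norm (g (e n) x) \<partial>M)"
    using sm r[of "\<lambda>j. \<integral>x. norm (g j x) \<partial>M"] by (auto intro: summable_on_imp_summable)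
  have i: "integrable M (\<lambda>x. \<Sum>n. g (e n) x)"
    using ae' by (intro integrable_suminf g sm') auto
  have "(\<lambda>n. \<integral>x. g (e n) x \<partial>M) sums (\<integral>x. (\<Sum>n. g (e n) x) \<partial>M)"
    using ae' by (intro sums_integral g sm') auto
  also have "(\<integral>x. (\<Sum>n. g (e n) x) \<partial>M) = (\<integral>x. h x \<partial>M)"
    using ae' i h by (intro integral_cong_AE) auto
  finally have s: "(\<lambda>n. \<integral>x. g (e n) x \<partial>M) sums (\<integral>x. h x \<partial>M)" .
  show "integrable M h"
    using i h ae' by (subst integrable_cong_AE[symmetric, where f="\<lambda>x. \<Sum>n. g (e n) x"]) auto
  have "summable (\<lambda>n. norm (\<integral>x. g (e n) x \<partial>M))"
    by (rule summable_comparison_test'[OF sm']) (simp add: integral_norm_bound)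
  then have "((\<lambda>n. \<integral>x. g (e n) x \<partial>M) has_sum (\<integral>x. h x \<partial>M)) UNIV"
    using s by (rule norm_summable_imp_has_sum)
  then show "((\<lambda>j. \<integral>x. g j x \<partial>M) has_sum (\<integral>x. h x \<partial>M)) UNIV"
    using has_sum_reindex_bij_betw[OF e, of "\<lambda>j. \<integral>x. g j x \<partial>M"] by simp
qed

lemma (in finite_measure) integral_has_sum_bounded:
  fixes g :: "'j::countable \<Rightarrow> 'a \<Rightarrow> 'b::{banach,second_countable_topology}"
  assumes inf: "infinite (UNIV :: 'j set)"
    and g: "\<And>j. g j \<in> borel_measurable M"
    and h: "h \<in> borel_measurable M"
    and hs: "AE x in M. ((\<lambda>j. g j x) has_sum h x) UNIV"
    and b: "\<And>j. AE x in M. norm (g j x) \<le> b j"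
    and sm: "b summable_on UNIV"
  shows "integrable M h" and "((\<lambda>j. \<integral>x. g j x \<partial>M) has_sum (\<integral>x. h x \<partial>M)) UNIV"
proof -
  have i: "integrable M (g j)" for j
    using b by (intro integrable_const_bound[where B="b j"] g)
  have "AE x in M. \<forall>j. norm (g j x) \<le> b j" using b by (simp add: AE_all_countable)
  then have ae: "AE x in M. (\<lambda>j. norm (g j x)) summable_on UNIV \<and> ((\<lambda>j. g j x) has_sum h x) UNIV"
    using hs by eventually_elim (auto intro: summable_on_comparison_test[OF sm])
  have le: "(\<integral>x. norm (g j x) \<partial>M) \<le> measure M (space M) * b j" for j
  proof -
    have "(\<integral>x. norm (g j x) \<partial>M) \<le> (\<integral>x. b j \<partial>M)"
      using i b by (intro integral_mono_AE) auto
    then show ?thesis by simp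
  qed
  have "(\<lambda>j. \<integral>x. norm (g j x) \<partial>M) summable_on UNIV"
    by (rule summable_on_comparison_test[OF summable_on_cmult_right[OF sm]]) (use le in auto)
  from integral_has_sum[OF inf i h ae this]
  show "integrable M h" and "((\<lambda>j. \<integral>x. g j x \<partial>M) has_sum (\<integral>x. h x \<partial>M)) UNIV" by auto
qed

section \<open>Lattice translates and the fundamental cell\<close>

abbreviation per :: "int ^ 'n \<Rightarrow> real ^ 'n" where "per m \<equiv> (2 * pi) *\<^sub>R lat m"

lemma infinite_int_vec: "infinite (UNIV :: (int ^ 'n) set)"
proof
  assume "finite (UNIV :: (int ^ 'n) set)"
  then have "finite (range (\<lambda>k::int. (vec k :: int ^ 'n)))" by (rule finite_subset[rotated]) auto
  moreover have "inj (\<lambda>k::int. (vec k :: int ^ 'n))" by (auto simp: inj_def vec_eq_iff)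
  ultimately show False using finite_imageD infinite_UNIV_int by blast
qed

lemma lat_simps: "lat 0 = 0" "lat (a + b) = lat a + lat b" "lat (- a) = - lat a" "lat (a - b) = lat a - lat b"
  by (auto simp: lat_def vec_eq_iff)

text \<open>A translation is the affine map all of whose scale factors are 1. The completed measure
  is used because the Fourier transforms at hand are merely Lebesgue measurable.\<close>

lemma lebesgue_distr_plus: "distr lebesgue lebesgue (\<lambda>x::'a::euclidean_space. t + x) = lebesgue"
  and measurable_lebesgue_plus: "(\<lambda>x. t + x) \<in> lebesgue \<rightarrow>\<^sub>M lebesgue"
proof -
  show "distr lebesgue lebesgue (\<lambda>x::'a::euclidean_space. t + x) = lebesgue"
    using lebesgue_affine_euclidean[of "\<lambda>_. 1" t] by (simp add: euclidean_representation density_1)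
  show "(\<lambda>x. t + x) \<in> lebesgue \<rightarrow>\<^sub>M lebesgue"
    using lebesgue_affine_measurable[of "\<lambda>_. 1" t] by (simp add: euclidean_representation)
qed

lemma lebesgue_integral_translation:
  fixes f :: "'a::euclidean_space \<Rightarrow> 'b::{banach,second_countable_topology}"
  assumes f: "f \<in> borel_measurable lebesgue"
  shows "(\<integral>x. f (t + x) \<partial>lebesgue) = (\<integral>x. f x \<partial>lebesgue)"
    and "integrable lebesgue (\<lambda>x. f (t + x)) \<longleftrightarrow> integrable lebesgue f"
    and "(\<lambda>x. f (t + x)) \<in> borel_measurable lebesgue"
proof -
  show "(\<integral>x. f (t + x) \<partial>lebesgue) = (\<integral>x. f x \<partial>lebesgue)"
    using integral_distr[OF measurable_lebesgue_plus f, of t] by (simp add: lebesgue_distr_plus)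
  show "integrable lebesgue (\<lambda>x. f (t + x)) \<longleftrightarrow> integrable lebesgue f"
    using integrable_distr_eq[OF measurable_lebesgue_plus f, of t] by (simp add: lebesgue_distr_plus)
  show "(\<lambda>x. f (t + x)) \<in> borel_measurable lebesgue"
    using measurable_comp[OF measurable_lebesgue_plus f] by (simp add: comp_def)
qed

lemma cube_cbox: "(cube :: (real^'n) set) = cbox (vec (- pi)) (vec pi)"
  by (auto simp: cube_def mem_box_cart)

lemma cube_lmeasurable [simp]: "(cube :: (real^'n) set) \<in> lmeasurable"
  and cube_sets [simp]: "(cube :: (real^'n) set) \<in> sets lebesgue"
  and compact_cube: "compact (cube :: (real^'n) set)"
  by (auto simp: cube_cbox)

lemma finite_measure_cube: "finite_measure (lebesgue_on (cube :: (real^'n) set))"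
  by (rule finite_measure_lebesgue_on) simp

lemma measure_lebesgue_cube: "measure lebesgue (cube :: (real^'n) set) = (2 * pi) ^ CARD('n)"
proof -
  have "measure lborel (cbox (vec (- pi)) (vec pi) :: (real^'n) set) = (\<Prod>i\<in>(UNIV::'n set). vec pi $ i - vec (- pi) $ i)"
    by (rule content_cbox_cart) (auto simp: interval_eq_empty_cart not_less intro!: exI[of _ "0"] simp flip: cube_cbox simp: cube_def)
  then show ?thesis by (simp add: cube_cbox measure_completion)
qed

text \<open>The faces lie in finitely many hyperplanes, which are null sets. This lets the closed
  cube of the definitions be exchanged for the half-open cell that tiles space.\<close>

lemma AE_cube_interior: "AE x in lebesgue. x \<in> (cube :: (real^'n) set) \<longrightarrow> (\<forall>i. - pi < x $ i \<and> x $ i < pi)"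
proof -
  have n: "{x::real^'n. x $ i = a} \<in> null_sets lebesgue" for i a
    using negligible_standard_hyperplane[of "axis i (1::real) :: real^'n" a]
    by (simp add: negligible_iff_null_sets inner_axis)
  have "AE x in lebesgue. x $ i \<noteq> pi \<and> x $ i \<noteq> - pi" for i :: 'n
    using AE_not_in[OF n[of i pi]] AE_not_in[OF n[of i "-pi"]] by auto
  then have "AE x in lebesgue. \<forall>i::'n. x $ i \<noteq> pi \<and> x $ i \<noteq> - pi" by (simp add: AE_all_countable)
  then show ?thesis
    by eventually_elim (metis (mono_tags, lifting) cube_def mem_Collect_eq order_le_less)
qed

text \<open>The cell is half-open because closed cubes share faces, which would destroy uniqueness.
  The index is the componentwise floor of (x_i + pi) / (2 pi).\<close>

lemma ex1_tile:
  fixes x :: "real ^ 'n"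
  defines "Q \<equiv> {x::real^'n. \<forall>i. - pi \<le> x $ i \<and> x $ i < pi}"
  shows "\<exists>j. \<forall>m. x - per m \<in> Q \<longleftrightarrow> m = j"
proof -
  define j :: "int ^ 'n" where "j = (\<chi> i. \<lfloor>(x $ i + pi) / (2 * pi)\<rfloor>)"
  have "- pi \<le> x $ i - 2 * pi * of_int k \<and> x $ i - 2 * pi * of_int k < pi \<longleftrightarrow> k = j $ i" for i k
  proof -
    have "k = j $ i \<longleftrightarrow> of_int k \<le> (x $ i + pi) / (2 * pi) \<and> (x $ i + pi) / (2 * pi) < of_int k + 1"
      unfolding j_def by (simp add: floor_eq_iff eq_commute[of k])
    also have "\<dots> \<longleftrightarrow> - pi \<le> x $ i - 2 * pi * of_int k \<and> x $ i - 2 * pi * of_int k < pi"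
      by (simp add: field_simps)
    finally show ?thesis by simp
  qed
  then show ?thesis
    by (intro exI[of _ j]) (auto simp: Q_def vec_eq_iff lat_def)
qed

text \<open>\<open>G\<close> is the sum of its restrictions to disjoint tiles. Each restriction,
  moved back to the cell, is bounded by \<open>b m\<close> on a set of finite measure, so
  summability of \<open>b\<close> permits termwise integration.\<close>

lemma tile_integral:
  fixes G :: "real ^ 'n \<Rightarrow> complex"
  assumes G: "G \<in> borel_measurable lebesgue"
    and b: "\<And>m. AE \<xi> in lebesgue_on cube. norm (G (\<xi> + per m)) \<le> b m"
    and sm: "b summable_on UNIV"
  shows "integrable lebesgue G"
    and "((\<lambda>m. LINT \<xi>|lebesgue_on cube. G (\<xi> + per m)) has_sum (LINT \<xi>|lebesgue. G \<xi>)) UNIV"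
proof -
  interpret finite_measure "lebesgue_on (cube :: (real^'n) set)" by (rule finite_measure_cube)
  define Q where "Q = {x::real^'n. \<forall>i. - pi \<le> x $ i \<and> x $ i < pi}"
  have "Q = (\<Inter>i. {x. - pi \<le> x $ i} \<inter> {x. x $ i < pi})" by (auto simp: Q_def)
  also have "\<dots> \<in> sets borel"
    by (intro sets.finite_INT sets.Int borel_closed borel_open closed_Collect_le open_Collect_less continuous_intros) auto
  finally have Qb[measurable]: "Q \<in> sets lebesgue" by simp
  define g where "g m \<xi> = indicator Q (\<xi> - per m) *\<^sub>R G \<xi>" for m \<xi>
  define k where "k m \<xi> = indicator cube \<xi> *\<^sub>R G (\<xi> + per m)" for m \<xi>
  have tr: "(\<lambda>\<xi>. u (\<xi> - t)) \<in> borel_measurable lebesgue" if "u \<in> borel_measurable lebesgue" for u :: "real^'n \<Rightarrow> real" and t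
    using lebesgue_integral_translation(3)[OF that, of "-t"] by (simp add: add.commute)
  have gm[measurable]: "g m \<in> borel_measurable lebesgue" for m
    unfolding g_def by (intro borel_measurable_scaleR G tr borel_measurable_indicator Qb)
  have Gm: "(\<lambda>\<xi>. G (\<xi> + per m)) \<in> borel_measurable lebesgue" for m
    using lebesgue_integral_translation(3)[OF G, of "per m"] by (simp add: add.commute)
  have km: "k m \<in> borel_measurable lebesgue" for m
    unfolding k_def by (intro borel_measurable_scaleR Gm borel_measurable_indicator cube_sets)
  \<comment> \<open>Here the half-open cell is replaced by the closed cube, at the price of a null
    set.\<close>
  have gk: "AE \<xi> in lebesgue. g m (per m + \<xi>) = k m \<xi>" for m
    using AE_cube_interior
  proof eventually_elim
    case (elim \<xi>)
    then have "\<xi> \<in> Q \<longleftrightarrow> \<xi> \<in> cube" unfolding Q_def cube_def mem_Collect_eq by (meson less_imp_le)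
    then have "(indicator Q \<xi> :: real) = indicator cube \<xi>" by (simp add: indicator_def)
    then show ?case unfolding g_def k_def by (simp add: add.commute)
  qed
  have gtm: "(\<lambda>\<xi>. g m (per m + \<xi>)) \<in> borel_measurable lebesgue" for m
    by (rule lebesgue_integral_translation(3)[OF gm])
  have Gi: "integrable (lebesgue_on cube) (\<lambda>\<xi>. G (\<xi> + per m))" for m
    by (intro integrable_const_bound[OF b] measurable_restrict_space1 Gm)
  then have ki: "integrable lebesgue (k m)" for m
    unfolding k_def by (subst (asm) integrable_restrict_space) simp_all
  have gi: "integrable lebesgue (g m)" for m
  proof -
    have "integrable lebesgue (\<lambda>\<xi>. g m (per m + \<xi>))"
      using integrable_cong_AE[OF gtm km gk] ki by blast
    then show ?thesis using lebesgue_integral_translation(2)[OF gm] by blast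
  qed
  have gint: "(\<integral>\<xi>. g m \<xi> \<partial>lebesgue) = (LINT \<xi>|lebesgue_on cube. G (\<xi> + per m))" for m
  proof -
    have "(\<integral>\<xi>. g m \<xi> \<partial>lebesgue) = (\<integral>\<xi>. k m \<xi> \<partial>lebesgue)"
      unfolding lebesgue_integral_translation(1)[OF gm, where t="per m", symmetric]
      by (rule integral_cong_AE[OF gtm km gk])
    then show ?thesis unfolding k_def by (simp add: integral_restrict_space)
  qed
  have gnorm: "(\<integral>\<xi>. norm (g m \<xi>) \<partial>lebesgue) \<le> measure lebesgue (cube :: (real^'n) set) * b m" for m
  proof -
    have "(\<integral>\<xi>. norm (g m \<xi>) \<partial>lebesgue) = (\<integral>\<xi>. norm (g m (per m + \<xi>)) \<partial>lebesgue)"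
      by (rule lebesgue_integral_translation(1)[symmetric]) measurable
    also have "\<dots> = (\<integral>\<xi>. norm (k m \<xi>) \<partial>lebesgue)"
    proof (rule integral_cong_AE)
      show "AE \<xi> in lebesgue. norm (g m (per m + \<xi>)) = norm (k m \<xi>)"
        using gk[of m] by eventually_elim simp
    qed (use gtm[of m] km[of m] in measurable)
    also have "\<dots> = (LINT \<xi>|lebesgue_on cube. norm (G (\<xi> + per m)))"
      unfolding k_def by (simp add: integral_restrict_space)
    also have "\<dots> \<le> (LINT \<xi>|lebesgue_on (cube :: (real^'n) set). b m)"
      by (intro integral_mono_AE integrable_norm Gi b) simp
    finally show ?thesis by (simp add: measure_restrict_space)
  qed
  \<comment> \<open>Every point lies in exactly one tile, so both sums have a single nonzero
    term.\<close>
  have pt: "(\<lambda>m. norm (g m \<xi>)) summable_on UNIV \<and> ((\<lambda>m. g m \<xi>) has_sum G \<xi>) UNIV" for \<xi>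
  proof -
    obtain j where j: "\<And>m. \<xi> - per m \<in> Q \<longleftrightarrow> m = j"
      using ex1_tile[of \<xi>] unfolding Q_def by blast
    have "((\<lambda>m. g m \<xi>) has_sum G \<xi>) UNIV"
      by (rule has_sum_finite_neutralI[of "{j}"]) (auto simp: g_def j)
    moreover have "(\<lambda>m. norm (g m \<xi>)) summable_on UNIV"
      by (rule has_sum_imp_summable[OF has_sum_finite_neutralI[of "{j}"]]) (auto simp: g_def j)
    ultimately show ?thesis by simp
  qed
  have sg: "(\<lambda>m. \<integral>\<xi>. norm (g m \<xi>) \<partial>lebesgue) summable_on UNIV"
    by (rule summable_on_comparison_test[OF summable_on_cmult_right[OF sm]]) (use gnorm in auto)
  have "AE \<xi> in lebesgue. (\<lambda>m. norm (g m \<xi>)) summable_on UNIV \<and> ((\<lambda>m. g m \<xi>) has_sum G \<xi>) UNIV"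
    using pt by simp
  note * = integral_has_sum[OF infinite_int_vec gi G this sg]
  show "integrable lebesgue G" by (rule *)
  show "((\<lambda>m. LINT \<xi>|lebesgue_on cube. G (\<xi> + per m)) has_sum (LINT \<xi>|lebesgue. G \<xi>)) UNIV"
    using *(2) by (simp add: gint)
qed

section \<open>Fourier series on the cube\<close>

text \<open>\<open>lborel\<close> is the image of the product measure under the map assembling a
  vector from its coordinates; there the claim is Fubini's theorem for products.\<close>

lemma lborel_integral_prod:
  fixes f :: "'a::euclidean_space \<Rightarrow> real \<Rightarrow> complex"
  assumes f: "\<And>b. b \<in> Basis \<Longrightarrow> integrable lborel (f b)"
  shows "integrable lborel (\<lambda>x::'a. \<Prod>b\<in>Basis. f b (x \<bullet> b))"
    and "(\<integral>x. (\<Prod>b\<in>Basis. f b (x \<bullet> b)) \<partial>lborel) = (\<Prod>b\<in>Basis. \<integral>t. f b t \<partial>lborel)"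
proof -
  interpret product_sigma_finite "\<lambda>_::'a. lborel :: real measure" ..
  let ?T = "\<lambda>y :: 'a \<Rightarrow> real. \<Sum>b\<in>Basis. y b *\<^sub>R b"
  have T: "?T \<in> (\<Pi>\<^sub>M b\<in>Basis. lborel) \<rightarrow>\<^sub>M (borel :: 'a measure)" by measurable
  have m: "(\<lambda>x::'a. \<Prod>b\<in>Basis. f b (x \<bullet> b)) \<in> borel_measurable borel"
    using f[THEN borel_measurable_integrable] by measurable
  have e: "(\<Prod>b\<in>Basis. f b (?T y \<bullet> b)) = (\<Prod>b\<in>Basis. f b (y b))" for y
    by (rule prod.cong) simp_all
  show "integrable lborel (\<lambda>x::'a. \<Prod>b\<in>Basis. f b (x \<bullet> b))"
    by (subst lborel_eq, subst integrable_distr_eq[OF T m], subst e)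
      (intro product_integrable_prod finite_Basis f)
  show "(\<integral>x. (\<Prod>b\<in>Basis. f b (x \<bullet> b)) \<partial>lborel) = (\<Prod>b\<in>Basis. \<integral>t. f b t \<partial>lborel)"
    by (subst lborel_eq, subst integral_distr[OF T m], subst e)
      (intro product_integral_prod finite_Basis f)
qed

lemma prod_Basis_vec:
  "(\<Prod>b\<in>(Basis :: (real ^ 'n) set). g b) = (\<Prod>i\<in>UNIV. g (axis i 1))"
proof -
  have B: "(Basis :: (real ^ 'n) set) = range (\<lambda>i. axis i 1)" by (auto simp: Basis_vec_def)
  have "inj (\<lambda>i::'n. axis i (1::real))" by (auto simp: inj_def axis_eq_axis)
  then show ?thesis unfolding B by (subst prod.reindex) auto
qed

lemma lebesgue_integral_prod:
  fixes f :: "'n::finite \<Rightarrow> real \<Rightarrow> complex"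
  assumes f: "\<And>i. integrable lborel (f i)"
  shows "integrable lebesgue (\<lambda>x::real^'n. \<Prod>i\<in>UNIV. f i (x $ i))"
    and "(LINT x|lebesgue. (\<Prod>i\<in>UNIV. f i (x $ i))) = (\<Prod>i\<in>UNIV. \<integral>t. f i t \<partial>lborel)"
proof -
  let ?f = "\<lambda>b::real^'n. f (axis_index b)"
  have e: "(\<Prod>b\<in>Basis. ?f b (x \<bullet> b)) = (\<Prod>i\<in>UNIV. f i (x $ i))" for x :: "real^'n"
    by (simp add: prod_Basis_vec axis_index_axis inner_axis)
  note * = lborel_integral_prod[of ?f, OF f, unfolded e, unfolded prod_Basis_vec axis_index_axis]
  show "integrable lebesgue (\<lambda>x::real^'n. \<Prod>i\<in>UNIV. f i (x $ i))"
    using *(1) borel_measurable_integrable[OF *(1)] by (simp add: integrable_completion)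
  show "(LINT x|lebesgue. (\<Prod>i\<in>UNIV. f i (x $ i))) = (\<Prod>i\<in>UNIV. \<integral>t. f i t \<partial>lborel)"
    using *(2) borel_measurable_integrable[OF *(1)] by (simp add: integral_completion)
qed

lemma cis_inner: "cis (a \<bullet> x) = (\<Prod>i\<in>UNIV. cis (a $ i * x $ i))" for a x :: "real ^ 'n"
  by (simp add: cis_conv_exp inner_vec_def exp_sum sum_distrib_left)

lemma integral_cis_interval:
  fixes k :: int
  shows "integrable lborel (\<lambda>t. indicator {-pi..pi} t *\<^sub>R cis (of_int k * t))"
    and "(\<integral>t. indicator {-pi..pi} t *\<^sub>R cis (of_int k * t) \<partial>lborel) = (if k = 0 then 2 * complex_of_real pi else 0)"
proof -
  have c: "continuous_on {-pi..pi} (\<lambda>t. cis (of_int k * t))" by (intro continuous_intros)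
  show "integrable lborel (\<lambda>t. indicator {-pi..pi} t *\<^sub>R cis (of_int k * t))"
    by (rule borel_integrable_compact[OF _ c]) simp
  show "(\<integral>t. indicator {-pi..pi} t *\<^sub>R cis (of_int k * t) \<partial>lborel) = (if k = 0 then 2 * complex_of_real pi else 0)"
  proof (cases "k = 0")
    case True
    then show ?thesis by (simp add: scaleR_conv_of_real)
  next
    case False
    have d: "((\<lambda>t. cis (of_int k * t) / (\<i> * of_int k)) has_vector_derivative cis (of_int k * x)) (at x within {-pi..pi})" for x
    proof -
      have "((\<lambda>z. exp (\<i> * (of_int k * z)) / (\<i> * of_int k)) has_field_derivative exp (\<i> * (of_int k * of_real x))) (at (of_real x))"
        using False by (auto intro!: derivative_eq_intros simp: field_simps)
      from has_vector_derivative_real_field[OF this, of "{-pi..pi}"]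
      show ?thesis by (simp add: cis_conv_exp)
    qed
    \<comment> \<open>For k \<noteq> 0 the antiderivative takes equal values at both ends, as the
      sine vanishes at integer multiples of pi.\<close>
    have "cis (of_int k * pi) = cis (of_int k * (- pi))"
      using sin_npi_int[of k] by (simp add: cis_def mult.commute complex_eq_iff)
    with integral_FTC_Icc[OF _ d c] False show ?thesis by simp
  qed
qed

lemma integral_cis_cube:
  fixes j :: "int ^ 'n"
  shows "(LINT \<xi>|lebesgue_on cube. cis (lat j \<bullet> \<xi>)) = (if j = 0 then of_real ((2 * pi) ^ CARD('n)) else 0)"
proof -
  have i: "indicator cube \<xi> *\<^sub>R cis (lat j \<bullet> \<xi>) = (\<Prod>i\<in>UNIV. indicator {-pi..pi} (\<xi> $ i) *\<^sub>R cis (of_int (j $ i) * \<xi> $ i))" for \<xi> :: "real^'n"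
  proof (cases "\<xi> \<in> cube")
    case True then show ?thesis by (auto simp: cis_inner cube_def lat_def)
  next
    case False
    then obtain i where "\<xi> $ i \<notin> {-pi..pi}" by (auto simp: cube_def)
    then have "indicator {-pi..pi} (\<xi> $ i) *\<^sub>R cis (of_int (j $ i) * \<xi> $ i) = 0" by simp
    then have "(\<Prod>i\<in>UNIV. indicator {-pi..pi} (\<xi> $ i) *\<^sub>R cis (of_int (j $ i) * \<xi> $ i)) = 0"
      by (intro prod_zero) auto
    then show ?thesis using False by simp
  qed
  have "(LINT \<xi>|lebesgue_on cube. cis (lat j \<bullet> \<xi>)) = (LINT \<xi>|lebesgue. indicator cube \<xi> *\<^sub>R cis (lat j \<bullet> \<xi>))"
    by (simp add: integral_restrict_space)
  also have "\<dots> = (\<Prod>i\<in>UNIV. \<integral>t. indicator {-pi..pi} t *\<^sub>R cis (of_int (j $ i) * t) \<partial>lborel)"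
    unfolding i by (rule lebesgue_integral_prod(2)) (rule integral_cis_interval)
  also have "\<dots> = (\<Prod>i\<in>UNIV. if j $ i = 0 then 2 * complex_of_real pi else 0)"
    by (simp add: integral_cis_interval(2))
  also have "\<dots> = (if j = 0 then of_real ((2 * pi) ^ CARD('n)) else 0)"
    by (auto simp: vec_eq_iff)
  finally show ?thesis .
qed

section \<open>Essentially bounded functions, Fourier coefficients and Bessel's inequality\<close>

abbreviation cubeM :: "(real ^ 'n) measure" where "cubeM \<equiv> lebesgue_on cube"

text \<open>Essentially bounded functions on the cube form an algebra closed under conjugation, and
  all of them are integrable. Working in this class disposes of the integrability conditions in the
  L2 computations below.\<close>

definition ebdd :: "(real ^ 'n \<Rightarrow> complex) \<Rightarrow> bool" where
  "ebdd g \<longleftrightarrow> g \<in> borel_measurable cubeM \<and> (\<exists>B. AE \<xi> in cubeM. norm (g \<xi>) \<le> B)"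

lemma ebddI: "g \<in> borel_measurable cubeM \<Longrightarrow> AE \<xi> in cubeM. norm (g \<xi>) \<le> B \<Longrightarrow> ebdd g"
  by (auto simp: ebdd_def)

lemma ebdd_integrable: "ebdd g \<Longrightarrow> integrable cubeM g"
  by (auto simp: ebdd_def intro!: finite_measure.integrable_const_bound[OF finite_measure_cube])

lemma ebdd_add: assumes "ebdd f" "ebdd g" shows "ebdd (\<lambda>\<xi>. f \<xi> + g \<xi>)"
proof -
  from assms obtain A B where "AE \<xi> in cubeM. norm (f \<xi>) \<le> A" "AE \<xi> in cubeM. norm (g \<xi>) \<le> B"
    by (auto simp: ebdd_def)
  then have "AE \<xi> in cubeM. norm (f \<xi> + g \<xi>) \<le> A + B"
    by eventually_elim (rule norm_triangle_mono)
  with assms show ?thesis by (auto simp: ebdd_def)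
qed

lemma ebdd_mult: assumes "ebdd f" "ebdd g" shows "ebdd (\<lambda>\<xi>. f \<xi> * g \<xi>)"
proof -
  from assms obtain A B where "AE \<xi> in cubeM. norm (f \<xi>) \<le> A" "AE \<xi> in cubeM. norm (g \<xi>) \<le> B"
    by (auto simp: ebdd_def)
  then have "AE \<xi> in cubeM. norm (f \<xi> * g \<xi>) \<le> A * B"
  proof eventually_elim
    case (elim \<xi>)
    have "0 \<le> A" using elim(1) norm_ge_zero[of "f \<xi>"] by linarith
    then show ?case using elim by (simp add: norm_mult mult_mono)
  qed
  with assms show ?thesis by (auto simp: ebdd_def)
qed

lemma ebdd_const: "ebdd (\<lambda>\<xi>. c)"
  by (rule ebddI[where B="norm c"]) auto

lemma ebdd_cmult: "ebdd f \<Longrightarrow> ebdd (\<lambda>\<xi>. c * f \<xi>)"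
  by (intro ebdd_mult ebdd_const)

lemma ebdd_uminus: "ebdd f \<Longrightarrow> ebdd (\<lambda>\<xi>. - f \<xi>)"
  using ebdd_cmult[of f "-1"] by simp

lemma ebdd_diff: "ebdd f \<Longrightarrow> ebdd g \<Longrightarrow> ebdd (\<lambda>\<xi>. f \<xi> - g \<xi>)"
  using ebdd_add[of f "\<lambda>\<xi>. - g \<xi>"] ebdd_uminus by auto

lemma ebdd_cnj: "ebdd f \<Longrightarrow> ebdd (\<lambda>\<xi>. cnj (f \<xi>))"
proof -
  have "cnj \<in> borel_measurable borel" by (intro borel_measurable_continuous_onI continuous_intros)
  then show "ebdd f \<Longrightarrow> ebdd (\<lambda>\<xi>. cnj (f \<xi>))"
    unfolding ebdd_def by (auto intro: measurable_compose)
qed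

lemma ebdd_cis: "ebdd (\<lambda>\<xi>. cis (a \<bullet> \<xi>))"
proof (rule ebddI[where B=1])
  have "(\<lambda>\<xi>. cis (a \<bullet> \<xi>)) \<in> borel_measurable borel"
    by (intro borel_measurable_continuous_onI continuous_intros)
  then show "(\<lambda>\<xi>. cis (a \<bullet> \<xi>)) \<in> borel_measurable cubeM"
    by (intro measurable_restrict_space1) (simp add: measurable_completion)
qed auto

lemma ebdd_sum: "finite S \<Longrightarrow> (\<And>j. j \<in> S \<Longrightarrow> ebdd (f j)) \<Longrightarrow> ebdd (\<lambda>\<xi>. \<Sum>j\<in>S. f j \<xi>)"
  by (induction S rule: finite_induct) (auto intro: ebdd_const ebdd_add)

text \<open>The coefficients are not normalised, so the volume (2 pi)^n of the cube appears as a
  factor in Bessel's inequality and in Parseval's identity.\<close>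

definition coef :: "(real ^ 'n \<Rightarrow> complex) \<Rightarrow> int ^ 'n \<Rightarrow> complex" where
  "coef g j = (LINT \<xi>|cubeM. g \<xi> * cis (- (lat j \<bullet> \<xi>)))"

lemma ebdd_coef: "ebdd g \<Longrightarrow> ebdd (\<lambda>\<xi>. g \<xi> * cis (- (lat j \<bullet> \<xi>)))"
  using ebdd_mult[OF _ ebdd_cis[of "- lat j"]] by simp

lemma coef_add: "ebdd f \<Longrightarrow> ebdd g \<Longrightarrow> coef (\<lambda>\<xi>. f \<xi> + g \<xi>) j = coef f j + coef g j"
  unfolding coef_def by (simp add: distrib_right ebdd_integrable ebdd_coef)

lemma coef_cmult: "coef (\<lambda>\<xi>. c * f \<xi>) j = c * coef f j"
  unfolding coef_def by (simp add: mult.assoc)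

lemma coef_diff: "ebdd f \<Longrightarrow> ebdd g \<Longrightarrow> coef (\<lambda>\<xi>. f \<xi> - g \<xi>) j = coef f j - coef g j"
  unfolding coef_def by (simp add: left_diff_distrib ebdd_integrable ebdd_coef)

lemma coef_cis: "coef (\<lambda>\<xi>::real^'n. cis (lat k \<bullet> \<xi>)) j = (if j = k then of_real ((2 * pi) ^ CARD('n)) else 0)"
proof -
  have "coef (\<lambda>\<xi>::real^'n. cis (lat k \<bullet> \<xi>)) j = (LINT \<xi>|cubeM. cis (lat (k - j) \<bullet> \<xi>))"
    unfolding coef_def by (simp add: cis_mult lat_simps inner_diff_left)
  then show ?thesis by (simp add: integral_cis_cube)
qed

definition energy :: "(real ^ 'n \<Rightarrow> complex) \<Rightarrow> real" where
  "energy g = (LINT \<xi>|cubeM. (norm (g \<xi>))\<^sup>2)"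

lemma energy_eq: "ebdd g \<Longrightarrow> of_real (energy g) = (LINT \<xi>|cubeM. g \<xi> * cnj (g \<xi>))"
  unfolding energy_def by (simp add: complex_norm_square del: of_real_power flip: integral_complex_of_real)

lemma energy_nonneg: "0 \<le> energy g"
  unfolding energy_def by simp

text \<open>\<open>p\<close> is the orthogonal projection of \<open>g\<close> onto the span of the
  exponentials with index in \<open>S\<close>. The remainder \<open>d\<close> is orthogonal to them,
  so its energy, which is nonnegative, is that of \<open>g\<close> minus the sum divided by
  \<open>W\<close>.\<close>

lemma bessel:
  fixes g :: "real ^ 'n \<Rightarrow> complex"
  assumes g: "ebdd g" and S: "finite S"
  shows "(\<Sum>j\<in>S. (norm (coef g j))\<^sup>2) \<le> (2 * pi) ^ CARD('n) * energy g"
proof -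
  define W where "W = (2 * pi) ^ CARD('n)"
  have W: "W > 0" by (simp add: W_def)
  \<comment> \<open>\<open>W\<close> is the squared norm of an exponential on the cube.\<close>
  define a where "a j = coef g j / of_real W" for j
  define p where "p \<xi> = (\<Sum>j\<in>S. a j * cis (lat j \<bullet> \<xi>))" for \<xi>
  have p: "ebdd p" unfolding p_def by (intro ebdd_sum S ebdd_cmult ebdd_cis)
  note eb = ebdd_mult ebdd_diff ebdd_cnj g p
  have lin: "(LINT \<xi>|cubeM. u \<xi> * cnj (p \<xi>)) = (\<Sum>j\<in>S. cnj (a j) * coef u j)" if u: "ebdd u" for u
  proof -
    have "(LINT \<xi>|cubeM. u \<xi> * cnj (p \<xi>)) = (LINT \<xi>|cubeM. (\<Sum>j\<in>S. cnj (a j) * (u \<xi> * cis (- (lat j \<bullet> \<xi>)))))"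
      unfolding p_def by (simp add: sum_distrib_left cis_cnj mult_ac)
    also have "\<dots> = (\<Sum>j\<in>S. cnj (a j) * coef u j)"
      unfolding coef_def by (subst Bochner_Integration.integral_sum) (auto intro!: ebdd_integrable ebdd_cmult ebdd_coef u)
    finally show ?thesis .
  qed
  have cp: "coef p j = coef g j" if "j \<in> S" for j
  proof -
    have "coef p j = (\<Sum>k\<in>S. a k * coef (\<lambda>\<xi>. cis (lat k \<bullet> \<xi>)) j)"
      unfolding p_def coef_def sum_distrib_right
      by (subst Bochner_Integration.integral_sum)
        (auto simp: mult.assoc intro!: ebdd_integrable ebdd_cmult ebdd_coef ebdd_cis)
    also have "\<dots> = a j * of_real W"
      using that S by (simp add: coef_cis W_def if_distrib sum.delta cong: if_cong)
    finally show ?thesis using W by (simp add: a_def)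
  qed
  define d where "d \<xi> = g \<xi> - p \<xi>" for \<xi>
  have d: "ebdd d" unfolding d_def by (intro eb)
  have cd: "coef d j = 0" if "j \<in> S" for j
    unfolding d_def using cp[OF that] by (simp add: coef_diff g p)
  have "of_real (energy d) = (LINT \<xi>|cubeM. d \<xi> * cnj (g \<xi>) - d \<xi> * cnj (p \<xi>))"
    by (subst energy_eq[OF d]) (simp add: d_def right_diff_distrib)
  also have "\<dots> = (LINT \<xi>|cubeM. d \<xi> * cnj (g \<xi>)) - (LINT \<xi>|cubeM. d \<xi> * cnj (p \<xi>))"
    by (intro Bochner_Integration.integral_diff ebdd_integrable eb d)
  \<comment> \<open>This is the orthogonality of the remainder to the projection.\<close>
  also have "(LINT \<xi>|cubeM. d \<xi> * cnj (p \<xi>)) = 0"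
    using lin[OF d] cd by simp
  also have "(LINT \<xi>|cubeM. d \<xi> * cnj (g \<xi>)) = (LINT \<xi>|cubeM. g \<xi> * cnj (g \<xi>)) - (LINT \<xi>|cubeM. p \<xi> * cnj (g \<xi>))"
    unfolding d_def left_diff_distrib by (intro Bochner_Integration.integral_diff ebdd_integrable eb)
  also have "(LINT \<xi>|cubeM. p \<xi> * cnj (g \<xi>)) = cnj (LINT \<xi>|cubeM. g \<xi> * cnj (p \<xi>))"
    by (simp add: mult.commute flip: Bochner_Integration.integral_cnj)
  also have "(LINT \<xi>|cubeM. g \<xi> * cnj (p \<xi>)) = of_real ((\<Sum>j\<in>S. (norm (coef g j))\<^sup>2) / W)"
    unfolding lin[OF g] by (simp add: a_def complex_norm_square sum_divide_distrib mult.commute del: of_real_power)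
  also have "(LINT \<xi>|cubeM. g \<xi> * cnj (g \<xi>)) = of_real (energy g)"
    by (rule energy_eq[OF g, symmetric])
  finally have "energy d = energy g - (\<Sum>j\<in>S. (norm (coef g j))\<^sup>2) / W"
    unfolding complex_cnj_complex_of_real of_real_diff[symmetric] diff_0_right of_real_eq_iff by simp
  then have "(\<Sum>j\<in>S. (norm (coef g j))\<^sup>2) / W \<le> energy g" using energy_nonneg[of d] by linarith
  then show ?thesis using W by (simp add: pos_divide_le_eq mult.commute W_def)
qed

text \<open>Cauchy-Schwarz, followed by Bessel's inequality for both factors. The opposite indices
  \<open>- j\<close> and \<open>j\<close> correspond to the integral of g * h without conjugation.
  The bound does not depend on \<open>S\<close>, so it passes to the infinite sum.\<close>

lemma coef_product_bound:
  fixes g h :: "real ^ 'n \<Rightarrow> complex"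
  assumes g: "ebdd g" and h: "ebdd h" and S: "finite S"
  shows "(\<Sum>j\<in>S. norm (coef g (- j) * coef h j)) \<le> (2 * pi) ^ CARD('n) * sqrt (energy g) * sqrt (energy h)"
proof -
  have "(\<Sum>j\<in>S. norm (coef g (- j) * coef h j)) \<le> L2_set (\<lambda>j. norm (coef g (- j))) S * L2_set (\<lambda>j. norm (coef h j)) S"
    using L2_set_mult_ineq[of "\<lambda>j. norm (coef g (- j))" "\<lambda>j. norm (coef h j)" S] by (simp add: norm_mult)
  also have "\<dots> \<le> sqrt ((2 * pi) ^ CARD('n) * energy g) * sqrt ((2 * pi) ^ CARD('n) * energy h)"
  proof (intro mult_mono)
    have "(\<Sum>j\<in>S. (norm (coef g (- j)))\<^sup>2) = (\<Sum>j\<in>uminus ` S. (norm (coef g j))\<^sup>2)"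
      by (subst sum.reindex) (auto simp: inj_on_def)
    then show "L2_set (\<lambda>j. norm (coef g (- j))) S \<le> sqrt ((2 * pi) ^ CARD('n) * energy g)"
      using bessel[OF g, of "uminus ` S"] S unfolding L2_set_def by (intro real_sqrt_le_mono) simp
    show "L2_set (\<lambda>j. norm (coef h j)) S \<le> sqrt ((2 * pi) ^ CARD('n) * energy h)"
      using bessel[OF h S] unfolding L2_set_def by (intro real_sqrt_le_mono)
  qed (auto simp: energy_nonneg L2_set_nonneg)
  also have "\<dots> = (2 * pi) ^ CARD('n) * sqrt (energy g) * sqrt (energy h)"
  proof -
    have "sqrt (c * x) * sqrt (c * y) = c * sqrt x * sqrt y" if "0 \<le> c" for c x y
      using that by (simp add: real_sqrt_mult mult_ac flip: power2_eq_square)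
    then show ?thesis by simp
  qed
  finally show ?thesis .
qed

lemma coef_product_abs_summable:
  fixes g h :: "real ^ 'n \<Rightarrow> complex"
  assumes g: "ebdd g" and h: "ebdd h"
  shows "(\<lambda>j. norm (coef g (- j) * coef h j)) summable_on UNIV"
    and "norm (\<Sum>\<^sub>\<infinity>j. coef g (- j) * coef h j) \<le> (2 * pi) ^ CARD('n) * sqrt (energy g) * sqrt (energy h)"
    and "(\<Sum>\<^sub>\<infinity>j. norm (coef g (- j) * coef h j)) \<le> (2 * pi) ^ CARD('n) * sqrt (energy g) * sqrt (energy h)"
proof -
  show s: "(\<lambda>j. norm (coef g (- j) * coef h j)) summable_on UNIV"
    by (rule nonneg_bdd_above_summable_on) (auto intro!: bdd_aboveI coef_product_bound[OF g h])
  show *: "(\<Sum>\<^sub>\<infinity>j. norm (coef g (- j) * coef h j)) \<le> (2 * pi) ^ CARD('n) * sqrt (energy g) * sqrt (energy h)"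
    by (rule infsum_le_finite_sums[OF s]) (rule coef_product_bound[OF g h])
  show "norm (\<Sum>\<^sub>\<infinity>j. coef g (- j) * coef h j) \<le> (2 * pi) ^ CARD('n) * sqrt (energy g) * sqrt (energy h)"
    using norm_infsum_bound[OF s] * by linarith
qed

section \<open>Trigonometric polynomials and their density\<close>

inductive trigpoly :: "(real ^ 'n \<Rightarrow> complex) \<Rightarrow> bool" where
  cis: "trigpoly (\<lambda>\<xi>. cis (lat j \<bullet> \<xi>))"
| add: "trigpoly p \<Longrightarrow> trigpoly q \<Longrightarrow> trigpoly (\<lambda>\<xi>. p \<xi> + q \<xi>)"
| cmult: "trigpoly p \<Longrightarrow> trigpoly (\<lambda>\<xi>. c * p \<xi>)"

lemma trigpoly_ebdd: "trigpoly p \<Longrightarrow> ebdd p"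
  by (induction rule: trigpoly.induct) (auto intro: ebdd_cis ebdd_add ebdd_cmult)

lemma trigpoly_const: "trigpoly (\<lambda>\<xi>. c)"
  using trigpoly.cmult[OF trigpoly.cis[of 0], of c] by (simp add: lat_simps)

lemma trigpoly_mult_cis: "trigpoly p \<Longrightarrow> trigpoly (\<lambda>\<xi>. cis (lat j \<bullet> \<xi>) * p \<xi>)"
proof (induction rule: trigpoly.induct)
  case (cis k)
  then show ?case using trigpoly.cis[of "j + k"] by (simp add: cis_mult lat_simps inner_add_left)
next
  case (add p q)
  then show ?case by (simp add: distrib_left trigpoly.add)
next
  case (cmult p c)
  then show ?case using trigpoly.cmult[OF cmult.IH, of c] by (simp add: mult_ac)
qed

lemma trigpoly_mult: "trigpoly p \<Longrightarrow> trigpoly q \<Longrightarrow> trigpoly (\<lambda>\<xi>. p \<xi> * q \<xi>)"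
proof (induction rule: trigpoly.induct)
  case (cis j) then show ?case by (rule trigpoly_mult_cis)
next
  case (add p p') then show ?case by (simp add: distrib_right trigpoly.add)
next
  case (cmult p c) then show ?case by (simp add: mult.assoc trigpoly.cmult)
qed

text \<open>Both sides are linear in \<open>p\<close>, and for a single exponential orthogonality
  leaves one term of the sum. The function \<open>g\<close> stays an arbitrary bounded one, so only
  one factor has to be approximated later.\<close>

lemma trigpoly_parseval:
  fixes g p :: "real ^ 'n \<Rightarrow> complex"
  assumes g: "ebdd g" and p: "trigpoly p"
  shows "((\<lambda>j. coef g (- j) * coef p j) has_sum of_real ((2 * pi) ^ CARD('n)) * (LINT \<xi>|cubeM. g \<xi> * p \<xi>)) UNIV"
  using p
proof (induction rule: trigpoly.induct)
  case (cis k)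
  have "coef g (- k) = (LINT \<xi>|cubeM. g \<xi> * cis (lat k \<bullet> \<xi>))" by (simp add: coef_def lat_simps)
  then show ?case
    by (intro has_sum_finite_neutralI[of "{k}"]) (auto simp: coef_cis)
next
  case (add p q)
  have "(LINT \<xi>|cubeM. g \<xi> * (p \<xi> + q \<xi>)) = (LINT \<xi>|cubeM. g \<xi> * p \<xi>) + (LINT \<xi>|cubeM. g \<xi> * q \<xi>)"
    unfolding distrib_left using add.hyps by (intro Bochner_Integration.integral_add ebdd_integrable ebdd_mult g trigpoly_ebdd)
  then show ?case
    using has_sum_add[OF add.IH] add.hyps by (simp add: coef_add trigpoly_ebdd distrib_left)
next
  case (cmult p c)
  have "(LINT \<xi>|cubeM. g \<xi> * (c * p \<xi>)) = c * (LINT \<xi>|cubeM. g \<xi> * p \<xi>)"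
    by (simp add: mult.left_commute)
  then show ?case
    using has_sum_cmult_right[OF cmult.IH, of c] by (simp add: coef_cmult mult_ac)
qed

text \<open>Equal cosines give equal absolute values; if moreover a = - b with a \<noteq> 0, equal
  sines force sin a = 0 and hence an endpoint. So \<open>cis\<close> glues nothing but the two ends
  of the interval.\<close>

lemma cis_eq_cis_pi:
  assumes "cis a = cis b" "a \<in> {-pi..pi}" "b \<in> {-pi..pi}"
  shows "a = b \<or> \<bar>a\<bar> = pi \<and> \<bar>b\<bar> = pi"
proof (rule ccontr)
  assume n: "\<not> ?thesis"
  have c: "cos \<bar>a\<bar> = cos \<bar>b\<bar>" and s: "sin a = sin b"
    using assms(1) by (auto simp: complex_eq_iff)
  have ab: "\<bar>a\<bar> = \<bar>b\<bar>" using assms(2,3) by (intro cos_inj_pi[OF _ _ _ _ c]) auto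
  with n have "a = - b" by (metis abs_eq_iff)
  then have "a \<noteq> 0" using n by auto
  have "\<bar>a\<bar> \<le> pi" using assms(2) by (simp add: abs_le_iff)
  then have "\<bar>a\<bar> < pi" using n ab by (simp add: less_le)
  have "sin a = 0" using s \<open>a = - b\<close> by simp
  then have "sin \<bar>a\<bar> = 0" by (auto simp: abs_if)
  with \<open>\<bar>a\<bar> < pi\<close> \<open>a \<noteq> 0\<close> sin_gt_zero[of "\<bar>a\<bar>"] show False by simp
qed

text \<open>\<open>E\<close> wraps the cube onto the torus and identifies only points on opposite
  faces. As \<open>h\<close> vanishes on the faces, it factors through \<open>E\<close> as a
  function on a compact set, to which the Stone-Weierstrass theorem applies.\<close>

lemma trigpoly_approx_real:
  fixes h :: "real ^ 'n \<Rightarrow> real"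
  assumes h: "continuous_on cube h" and z: "\<And>\<xi> i. \<xi> \<in> cube \<Longrightarrow> \<bar>\<xi> $ i\<bar> = pi \<Longrightarrow> h \<xi> = 0" and e: "0 < e"
  shows "\<exists>p. trigpoly p \<and> (\<forall>\<xi>\<in>cube. norm (of_real (h \<xi>) - p \<xi>) < e)"
proof -
  define E :: "real ^ 'n \<Rightarrow> complex ^ 'n" where "E \<xi> = (\<chi> i. cis (\<xi> $ i))" for \<xi>
  have E: "continuous_on X E" for X
    unfolding E_def by (intro continuous_intros)
  \<comment> \<open>The choice of a preimage is harmless: two distinct preimages of a point both lie
    on faces, where \<open>h\<close> is 0.\<close>
  define k where "k z = h (SOME \<xi>. \<xi> \<in> cube \<and> E \<xi> = z)" for z
  have kE: "k (E \<xi>) = h \<xi>" if \<xi>: "\<xi> \<in> cube" for \<xi>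
  proof -
    define \<eta> where "\<eta> = (SOME \<eta>. \<eta> \<in> cube \<and> E \<eta> = E \<xi>)"
    have \<eta>: "\<eta> \<in> cube \<and> E \<eta> = E \<xi>" unfolding \<eta>_def by (rule someI[of _ \<xi>]) (use \<xi> in simp)
    have "h \<eta> = h \<xi>"
    proof (cases "\<eta> = \<xi>")
      case False
      then obtain i where i: "\<eta> $ i \<noteq> \<xi> $ i" by (auto simp: vec_eq_iff)
      have "cis (\<eta> $ i) = cis (\<xi> $ i)" using \<eta> by (simp add: E_def vec_eq_iff)
      then have "\<bar>\<eta> $ i\<bar> = pi \<and> \<bar>\<xi> $ i\<bar> = pi"
        using cis_eq_cis_pi[of "\<eta> $ i" "\<xi> $ i"] i \<eta> \<xi> by (auto simp: cube_def)
      then show ?thesis using z \<eta> \<xi> by metis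
    qed simp
    then show ?thesis by (simp add: k_def \<eta>_def)
  qed
  have cT: "compact (E ` cube)" by (intro compact_continuous_image E compact_cube)
  \<comment> \<open>The factor \<open>k\<close> inherits continuity because \<open>E\<close> maps
    compact subsets of the cube to compact, hence closed, sets.\<close>
  have k: "continuous_on (E ` cube) k"
    unfolding continuous_on_closed_vimage[OF compact_imp_closed[OF cT]]
  proof (intro allI impI)
    fix B :: "real set" assume B: "closed B"
    have "k -` B \<inter> E ` cube = E ` (h -` B \<inter> cube)" using kE by auto
    moreover have "closed (h -` B \<inter> cube)"
      using h B continuous_on_closed_vimage[OF compact_imp_closed[OF compact_cube]] by blast
    then have "compact (h -` B \<inter> cube)"
      using compact_Int_closed[OF compact_cube, of "h -` B \<inter> cube"] by (simp add: Int_commute Int_left_commute)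
    then have "closed (E ` (h -` B \<inter> cube))"
      by (intro compact_imp_closed compact_continuous_image E)
    ultimately show "closed (k -` B \<inter> E ` cube)" by simp
  qed
  \<comment> \<open>The algebra of continuous real functions on the torus whose pullback to the cube
    is a trigonometric polynomial. Real and imaginary parts of the coordinates belong to it and
    separate points.\<close>
  define P where "P u \<longleftrightarrow> continuous_on (E ` cube) u \<and> trigpoly (\<lambda>\<xi>. of_real (u (E \<xi>)))" for u :: "complex ^ 'n \<Rightarrow> real"
  have lat_axis: "lat (axis i 1) \<bullet> \<xi> = \<xi> $ i" for i and \<xi> :: "real ^ 'n"
  proof -
    have "lat (axis i 1) = axis i (1::real)" by (simp add: lat_def axis_def vec_eq_iff)
    then show ?thesis by (simp add: inner_axis')
  qed
  have t1: "trigpoly (\<lambda>\<xi>::real^'n. cis (\<xi> $ i))" for i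
    using trigpoly.cis[of "axis i 1"] by (simp add: lat_axis)
  have t2: "trigpoly (\<lambda>\<xi>::real^'n. cis (- (\<xi> $ i)))" for i
    using trigpoly.cis[of "- axis i 1"] by (simp add: lat_axis lat_simps)
  have PRe: "P (\<lambda>z. Re (z $ i))" for i
  proof -
    have "trigpoly (\<lambda>\<xi>::real^'n. (1/2) * (cis (\<xi> $ i) + cis (- (\<xi> $ i))))"
      by (intro trigpoly.cmult trigpoly.add t1 t2)
    also have "(\<lambda>\<xi>::real^'n. (1/2) * (cis (\<xi> $ i) + cis (- (\<xi> $ i)))) = (\<lambda>\<xi>. of_real (Re (E \<xi> $ i)))"
      by (auto simp: E_def complex_eq_iff)
    finally show ?thesis unfolding P_def by (auto intro!: continuous_intros)
  qed
  have PIm: "P (\<lambda>z. Im (z $ i))" for i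
  proof -
    have "trigpoly (\<lambda>\<xi>::real^'n. (-\<i>/2) * (cis (\<xi> $ i) + (-1) * cis (- (\<xi> $ i))))"
      by (intro trigpoly.cmult trigpoly.add t1 t2)
    also have "(\<lambda>\<xi>::real^'n. (-\<i>/2) * (cis (\<xi> $ i) + (-1) * cis (- (\<xi> $ i)))) = (\<lambda>\<xi>. of_real (Im (E \<xi> $ i)))"
      by (auto simp: E_def complex_eq_iff)
    finally show ?thesis unfolding P_def by (auto intro!: continuous_intros)
  qed
  have "\<exists>u. P u \<and> (\<forall>x\<in>E ` cube. \<bar>k x - u x\<bar> < e)"
  proof (rule Stone_Weierstrass_HOL[where P=P, OF cT _ _ _ _ _ k e])
    show "P (\<lambda>x. c)" for c by (simp add: P_def trigpoly_const)
    show "continuous_on (E ` cube) f" if "P f" for f using that by (simp add: P_def)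
    show "P (\<lambda>x. f x + g x)" if "P f \<and> P g" for f g
      using that by (auto simp: P_def intro!: continuous_intros trigpoly.add)
    show "P (\<lambda>x. f x * g x)" if "P f \<and> P g" for f g
      using that by (auto simp: P_def intro!: continuous_intros trigpoly_mult)
    show "\<exists>f. P f \<and> f x \<noteq> f y" if "x \<in> E ` cube \<and> y \<in> E ` cube \<and> x \<noteq> y" for x y
    proof -
      from that obtain i where "x $ i \<noteq> y $ i" by (auto simp: vec_eq_iff)
      then have "Re (x $ i) \<noteq> Re (y $ i) \<or> Im (x $ i) \<noteq> Im (y $ i)" by (auto simp: complex_eq_iff)
      then show ?thesis using PRe[of i] PIm[of i] by blast
    qed
  qed
  then obtain u where u: "P u" "\<And>x. x \<in> E ` cube \<Longrightarrow> \<bar>k x - u x\<bar> < e" by blast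
  show ?thesis
  proof (intro exI conjI ballI)
    show "trigpoly (\<lambda>\<xi>. of_real (u (E \<xi>)))" using u(1) by (simp add: P_def)
    fix \<xi> :: "real ^ 'n" assume "\<xi> \<in> cube"
    then show "norm (of_real (h \<xi>) - (of_real (u (E \<xi>)) :: complex)) < e"
      using u(2)[of "E \<xi>"] kE[of \<xi>] by (simp flip: of_real_diff)
  qed
qed

lemma trigpoly_approx:
  fixes h :: "real ^ 'n \<Rightarrow> complex"
  assumes h: "continuous_on cube h" and z: "\<And>\<xi> i. \<xi> \<in> cube \<Longrightarrow> \<bar>\<xi> $ i\<bar> = pi \<Longrightarrow> h \<xi> = 0" and e: "0 < e"
  shows "\<exists>p. trigpoly p \<and> (\<forall>\<xi>\<in>cube. norm (h \<xi> - p \<xi>) < e)"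
proof -
  obtain p where p: "trigpoly p" "\<And>\<xi>. \<xi> \<in> cube \<Longrightarrow> norm (of_real (Re (h \<xi>)) - p \<xi>) < e / 2"
  proof -
    have "\<exists>p. trigpoly p \<and> (\<forall>\<xi>\<in>cube. norm (of_real (Re (h \<xi>)) - p \<xi>) < e / 2)"
      by (rule trigpoly_approx_real) (use z e in \<open>auto intro!: continuous_intros h\<close>)
    then show ?thesis using that by blast
  qed
  obtain q where q: "trigpoly q" "\<And>\<xi>. \<xi> \<in> cube \<Longrightarrow> norm (of_real (Im (h \<xi>)) - q \<xi>) < e / 2"
  proof -
    have "\<exists>p. trigpoly p \<and> (\<forall>\<xi>\<in>cube. norm (of_real (Im (h \<xi>)) - p \<xi>) < e / 2)"
      by (rule trigpoly_approx_real) (use z e in \<open>auto intro!: continuous_intros h\<close>)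
    then show ?thesis using that by blast
  qed
  show ?thesis
  proof (intro exI[of _ "\<lambda>\<xi>. p \<xi> + \<i> * q \<xi>"] conjI ballI trigpoly.add trigpoly.cmult p q)
    fix \<xi> :: "real ^ 'n" assume \<xi>: "\<xi> \<in> cube"
    have "h \<xi> - (p \<xi> + \<i> * q \<xi>) = (of_real (Re (h \<xi>)) - p \<xi>) + \<i> * (of_real (Im (h \<xi>)) - q \<xi>)"
      by (subst complex_eq[of "h \<xi>"]) (simp add: algebra_simps)
    also have "norm \<dots> \<le> norm (of_real (Re (h \<xi>)) - p \<xi>) + norm (of_real (Im (h \<xi>)) - q \<xi>)"
      using norm_triangle_ineq by (metis norm_ii norm_mult mult_1)
    also have "\<dots> < e" using p(2)[OF \<xi>] q(2)[OF \<xi>] by linarith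
    finally show "norm (h \<xi> - (p \<xi> + \<i> * q \<xi>)) < e" .
  qed
qed

text \<open>Lebesgue measurability provides continuous functions converging almost everywhere. They
  are truncated to a fixed ball and cut off near the faces, which makes them uniformly approximable;
  the result converges almost everywhere and stays bounded, as dominated convergence
  requires.\<close>

lemma ebdd_trigpoly_limit:
  fixes g :: "real ^ 'n \<Rightarrow> complex"
  assumes g: "ebdd g"
  obtains p B where "\<And>n. trigpoly (p n)" "\<And>n \<xi>. \<xi> \<in> cube \<Longrightarrow> norm (p n \<xi>) \<le> B"
    "AE \<xi> in cubeM. (\<lambda>n::nat. p n \<xi>) \<longlonglongrightarrow> g \<xi>"
proof -
  obtain B0 where B0: "AE \<xi> in cubeM. norm (g \<xi>) \<le> B0" using g by (auto simp: ebdd_def)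
  \<comment> \<open>Taking the maximum with 0 ensures that the truncating ball is nonempty.\<close>
  define B where "B = max 0 B0"
  have B: "AE \<xi> in cubeM. norm (g \<xi>) \<le> B" using B0 by eventually_elim (simp add: B_def)
  have "g measurable_on cube"
    using g by (subst measurable_on_iff_borel_measurable) (auto simp: ebdd_def)
  then obtain N u where N: "negligible N" and u: "\<And>n::nat. continuous_on UNIV (u n)"
    and lim: "\<And>x. x \<notin> N \<Longrightarrow> (\<lambda>n. u n x) \<longlonglongrightarrow> (if x \<in> cube then g x else 0)"
    unfolding measurable_on_def by blast
  \<comment> \<open>This product is positive inside the cube and zero on its faces, since half of a
    coordinate lies in [-pi/2, pi/2].\<close>
  define ch where "ch \<xi> = (\<Prod>i\<in>UNIV. cos (\<xi> $ i / 2))" for \<xi> :: "real ^ 'n"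
  \<comment> \<open>The nearest-point projection onto a closed ball is continuous and fixes the
    values of \<open>g\<close> almost everywhere, so truncation does not disturb the limit.\<close>
  define r where "r = closest_point (cball (0::complex) B)"
  have cb: "closed (cball (0::complex) B)" "convex (cball (0::complex) B)" "cball (0::complex) B \<noteq> {}"
    by (auto simp: B_def)
  have rc: "continuous_on X r" for X
    unfolding r_def by (rule continuous_on_subset[OF continuous_on_closest_point[OF cb(2,1,3)]]) auto
  have rB: "norm (r z) \<le> B" for z
    using closest_point_in_set[OF cb(1,3), of z] by (simp add: r_def)
  have rid: "r z = z" if "norm z \<le> B" for z
    using that by (simp add: r_def closest_point_self)
  \<comment> \<open>The factor \<open>min 1 (real n * ch \<xi>)\<close> vanishes on the faces, and
    at every interior point equals 1 from some \<open>n\<close> on.\<close>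
  define h where "h n \<xi> = of_real (min 1 (real n * ch \<xi>)) * r (u n \<xi>)" for n \<xi>
  have ch0: "0 \<le> ch \<xi>" if "\<xi> \<in> cube" for \<xi>
    unfolding ch_def using that by (intro prod_nonneg ballI cos_ge_zero) (auto simp: cube_def)
  have hB: "norm (h n \<xi>) \<le> B" if "\<xi> \<in> cube" for n \<xi>
  proof -
    have "\<bar>min 1 (real n * ch \<xi>)\<bar> * norm (r (u n \<xi>)) \<le> 1 * B"
      using ch0[OF that] rB by (intro mult_mono) auto
    then show ?thesis by (simp add: h_def norm_mult)
  qed
  have hz: "h n \<xi> = 0" if "\<bar>\<xi> $ i\<bar> = pi" for n \<xi> i
  proof -
    have "cos (\<xi> $ i / 2) = cos \<bar>\<xi> $ i / 2\<bar>" by (rule cos_abs_real[symmetric])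
    also have "\<bar>\<xi> $ i / 2\<bar> = pi / 2" using that by simp
    finally have "cos (\<xi> $ i / 2) = 0" by simp
    then have "ch \<xi> = 0" unfolding ch_def by (intro prod_zero) auto
    then show ?thesis by (simp add: h_def)
  qed
  have hc: "continuous_on cube (h n)" for n
  proof -
    have "continuous_on cube (\<lambda>\<xi>. r (u n \<xi>))"
      using continuous_on_compose[of cube "u n" r] rc continuous_on_subset[OF u] by (simp add: comp_def)
    then show ?thesis unfolding h_def ch_def by (intro continuous_intros) auto
  qed
  have "\<exists>p. trigpoly p \<and> (\<forall>\<xi>\<in>cube. norm (h n \<xi> - p \<xi>) < 1 / Suc n)" for n
    by (rule trigpoly_approx[OF hc]) (auto simp: hz)
  then obtain p where p: "\<And>n. trigpoly (p n)" and hp: "\<And>n \<xi>. \<xi> \<in> cube \<Longrightarrow> norm (h n \<xi> - p n \<xi>) < 1 / Suc n"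
    by metis
  show thesis
  proof (rule that[of p "B + 1"])
    show "trigpoly (p n)" for n by (rule p)
    show "norm (p n \<xi>) \<le> B + 1" if "\<xi> \<in> cube" for n \<xi>
    proof -
      have "norm (p n \<xi>) \<le> norm (h n \<xi>) + norm (h n \<xi> - p n \<xi>)"
        by (metis norm_minus_commute norm_triangle_sub)
      moreover have "1 / Suc n \<le> 1" by simp
      ultimately show ?thesis using hB[OF that, of n] hp[OF that, of n] by linarith
    qed
    have N': "AE \<xi> in lebesgue. \<xi> \<notin> N" using N by (intro AE_not_in) (simp add: negligible_iff_null_sets)
    have B': "AE \<xi> in lebesgue. \<xi> \<in> cube \<longrightarrow> norm (g \<xi>) \<le> B"
      using B by (simp add: AE_restrict_space_iff)
    have "AE \<xi> in lebesgue. \<xi> \<in> cube \<longrightarrow> (\<lambda>n. p n \<xi>) \<longlonglongrightarrow> g \<xi>"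
      using N' B' AE_cube_interior
    proof eventually_elim
      case (elim \<xi>)
      show ?case
      proof
        assume c: "\<xi> \<in> cube"
        have "0 < cos (\<xi> $ i / 2)" for i using elim(3) c by (intro cos_gt_zero_pi) (auto simp: field_simps)
        then have pos: "0 < ch \<xi>" unfolding ch_def by (intro prod_pos) auto
        obtain m where m: "1 / ch \<xi> \<le> real m" using real_arch_simple by blast
        have "1 \<le> real n * ch \<xi>" if "m \<le> n" for n
        proof -
          have "1 / ch \<xi> \<le> real n" using m that by linarith
          then show ?thesis using pos by (simp add: field_simps)
        qed
        then have "eventually (\<lambda>n. min 1 (real n * ch \<xi>) = 1) sequentially"
          by (intro eventually_sequentiallyI[of m]) auto
        then have 1: "(\<lambda>n. min 1 (real n * ch \<xi>)) \<longlonglongrightarrow> 1" by (rule tendsto_eventually)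
        have "(\<lambda>n. u n \<xi>) \<longlonglongrightarrow> g \<xi>" using lim[of \<xi>] elim(1) c by simp
        then have "(\<lambda>n. r (u n \<xi>)) \<longlonglongrightarrow> r (g \<xi>)"
          using rc[of UNIV] by (intro continuous_on_tendsto_compose[of UNIV r]) auto
        also have "r (g \<xi>) = g \<xi>" using rid elim(2) c by simp
        finally have h: "(\<lambda>n. h n \<xi>) \<longlonglongrightarrow> of_real 1 * g \<xi>"
          unfolding h_def by (intro tendsto_intros 1)
        have "(\<lambda>n. h n \<xi> - p n \<xi>) \<longlonglongrightarrow> 0"
          by (rule Lim_null_comparison[OF _ LIMSEQ_inverse_real_of_nat])
            (use hp[OF c] in \<open>auto intro!: always_eventually less_imp_le simp: inverse_eq_divide\<close>)
        from tendsto_diff[OF h this] show "(\<lambda>n. p n \<xi>) \<longlonglongrightarrow> g \<xi>" by simp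
      qed
    qed
    then show "AE \<xi> in cubeM. (\<lambda>n::nat. p n \<xi>) \<longlonglongrightarrow> g \<xi>"
      by (simp add: AE_restrict_space_iff)
  qed
qed

text \<open>The identity holds for the trigonometric polynomials \<open>p n\<close> approximating
  \<open>h\<close>. The integrals converge by dominated convergence, and the sums converge because
  their difference is controlled by the L2 norm of \<open>h - p n\<close>.\<close>

theorem parseval:
  fixes g h :: "real ^ 'n \<Rightarrow> complex"
  assumes g: "ebdd g" and h: "ebdd h"
  shows "((\<lambda>j. coef g (- j) * coef h j) has_sum of_real ((2 * pi) ^ CARD('n)) * (LINT \<xi>|cubeM. g \<xi> * h \<xi>)) UNIV"
proof -
  interpret finite_measure "cubeM :: (real^'n) measure" by (rule finite_measure_cube)
  define W where "W = (2 * pi) ^ CARD('n)"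
  obtain p B where p: "\<And>n. trigpoly (p n)" and pB: "\<And>n \<xi>. \<xi> \<in> cube \<Longrightarrow> norm (p n \<xi>) \<le> B"
    and lim: "AE \<xi> in cubeM. (\<lambda>n::nat. p n \<xi>) \<longlonglongrightarrow> h \<xi>"
    using ebdd_trigpoly_limit[OF h] by blast
  have pe: "ebdd (p n)" for n by (rule trigpoly_ebdd[OF p])
  obtain A where A: "AE \<xi> in cubeM. norm (g \<xi>) \<le> A" using g by (auto simp: ebdd_def)
  obtain D where D: "AE \<xi> in cubeM. norm (h \<xi>) \<le> D" using h by (auto simp: ebdd_def)
  have AEc: "AE \<xi> in (cubeM :: (real^'n) measure). \<xi> \<in> cube" using AE_space[of cubeM] by simp
  have [measurable]: "g \<in> borel_measurable cubeM" "h \<in> borel_measurable cubeM" "p n \<in> borel_measurable cubeM" for n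
    using g h pe by (auto simp: ebdd_def)
  \<comment> \<open>Writing the limit as the energy of the zero function exhibits it as an integral;
    the majorant is constant on a set of finite measure.\<close>
  have 1: "(\<lambda>n. energy (\<lambda>\<xi>. h \<xi> - p n \<xi>)) \<longlonglongrightarrow> energy (\<lambda>\<xi>::real^'n. 0)"
    unfolding energy_def
  proof (rule integral_dominated_convergence[where w="\<lambda>_. (D + B)\<^sup>2"])
    show "AE \<xi> in cubeM. (\<lambda>n. (norm (h \<xi> - p n \<xi>))\<^sup>2) \<longlonglongrightarrow> (norm (0::complex))\<^sup>2"
      using lim
    proof eventually_elim
      case (elim \<xi>)
      have "(\<lambda>n. (norm (h \<xi> - p n \<xi>))\<^sup>2) \<longlonglongrightarrow> (norm (h \<xi> - h \<xi>))\<^sup>2"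
        by (intro tendsto_intros elim)
      then show ?case by simp
    qed
    show "AE \<xi> in cubeM. norm ((norm (h \<xi> - p n \<xi>))\<^sup>2) \<le> (D + B)\<^sup>2" for n
      using D AEc
    proof eventually_elim
      case (elim \<xi>)
      have "norm (h \<xi> - p n \<xi>) \<le> D + B"
        using norm_triangle_ineq4[of "h \<xi>" "p n \<xi>"] elim pB[of \<xi> n] by linarith
      then show ?case by (simp add: power_mono)
    qed
  qed auto
  have 2: "(\<lambda>n. LINT \<xi>|cubeM. g \<xi> * p n \<xi>) \<longlonglongrightarrow> (LINT \<xi>|cubeM. g \<xi> * h \<xi>)"
  proof (rule integral_dominated_convergence[where w="\<lambda>_. A * B"])
    show "AE \<xi> in cubeM. (\<lambda>n. g \<xi> * p n \<xi>) \<longlonglongrightarrow> g \<xi> * h \<xi>"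
      using lim by eventually_elim (intro tendsto_intros)
    show "AE \<xi> in cubeM. norm (g \<xi> * p n \<xi>) \<le> A * B" for n
      using A AEc
    proof eventually_elim
      case (elim \<xi>)
      have "0 \<le> A" using elim(1) norm_ge_zero[of "g \<xi>"] by linarith
      then show ?case using elim pB[of \<xi> n] by (simp add: norm_mult mult_mono)
    qed
  qed auto
  define T where "T u = (\<Sum>\<^sub>\<infinity>j. coef g (- j) * coef u j)" for u
  have s: "(\<lambda>j. coef g (- j) * coef u j) summable_on UNIV" if "ebdd u" for u
    using coef_product_abs_summable(1)[OF g that] by (rule abs_summable_summable)
  have Tp: "T (p n) = of_real W * (LINT \<xi>|cubeM. g \<xi> * p n \<xi>)" for n
    unfolding T_def W_def by (rule infsumI[OF trigpoly_parseval[OF g p]])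
  have Td: "T h - T (p n) = T (\<lambda>\<xi>. h \<xi> - p n \<xi>)" for n
  proof -
    have "((\<lambda>j. coef g (- j) * coef h j + (- (coef g (- j) * coef (p n) j))) has_sum T h + (- T (p n))) UNIV"
      unfolding T_def by (intro has_sum_add has_sum_uminusI has_sum_infsum s h pe)
    then have "((\<lambda>j. coef g (- j) * coef (\<lambda>\<xi>. h \<xi> - p n \<xi>) j) has_sum T h - T (p n)) UNIV"
      by (simp add: coef_diff h pe right_diff_distrib)
    then show ?thesis unfolding T_def using infsumI by force
  qed
  have "(\<lambda>n. T (\<lambda>\<xi>. h \<xi> - p n \<xi>)) \<longlonglongrightarrow> 0"
  proof (rule Lim_null_comparison)
    show "eventually (\<lambda>n. norm (T (\<lambda>\<xi>. h \<xi> - p n \<xi>)) \<le> W * sqrt (energy g) * sqrt (energy (\<lambda>\<xi>. h \<xi> - p n \<xi>))) sequentially"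
      unfolding T_def W_def by (intro always_eventually allI coef_product_abs_summable(2) g ebdd_diff h pe)
    have "(\<lambda>n. W * sqrt (energy g) * sqrt (energy (\<lambda>\<xi>. h \<xi> - p n \<xi>))) \<longlonglongrightarrow> W * sqrt (energy g) * sqrt (energy (\<lambda>\<xi>::real^'n. 0))"
      by (intro tendsto_intros 1)
    then show "(\<lambda>n. W * sqrt (energy g) * sqrt (energy (\<lambda>\<xi>. h \<xi> - p n \<xi>))) \<longlonglongrightarrow> 0"
      by (simp add: energy_def)
  qed
  then have "(\<lambda>n. T h - T (\<lambda>\<xi>. h \<xi> - p n \<xi>)) \<longlonglongrightarrow> T h - 0" by (intro tendsto_intros)
  then have "(\<lambda>n. T (p n)) \<longlonglongrightarrow> T h" by (simp flip: Td)
  moreover have "(\<lambda>n. T (p n)) \<longlonglongrightarrow> of_real W * (LINT \<xi>|cubeM. g \<xi> * h \<xi>)"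
    unfolding Tp by (intro tendsto_intros 2)
  ultimately have "T h = of_real W * (LINT \<xi>|cubeM. g \<xi> * h \<xi>)" by (rule LIMSEQ_unique)
  then show ?thesis using has_sum_infsum[OF s[OF h]] by (simp add: T_def W_def)
qed

section \<open>Fourier inversion by Gaussian test functions\<close>

lemma gaussian_poly_bound:
  fixes s :: real
  assumes s: "0 < s"
  shows "\<exists>C. \<forall>r\<ge>0. (1 + r) ^ N * exp (- (s * r)\<^sup>2 / 2) \<le> C"
proof -
  have "((\<lambda>r. (1 + r) ^ N * exp (- (s * r)\<^sup>2 / 2)) \<longlongrightarrow> 0) at_top"
    using s by real_asymp
  then have "eventually (\<lambda>r. (1 + r) ^ N * exp (- (s * r)\<^sup>2 / 2) < 1) at_top"
    by (rule order_tendstoD) simp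
  then obtain R where R: "\<And>r. R \<le> r \<Longrightarrow> (1 + r) ^ N * exp (- (s * r)\<^sup>2 / 2) < 1"
    by (auto simp: eventually_at_top_linorder)
  show ?thesis
  \<comment> \<open>Beyond \<open>R\<close> the product is below 1; before \<open>R\<close> the
    Gaussian is at most 1 and the polynomial at most its value at \<open>R\<close>.\<close>
  proof (intro exI[of _ "max 1 ((1 + R) ^ N)"] allI impI)
    fix r :: real assume r: "0 \<le> r"
    show "(1 + r) ^ N * exp (- (s * r)\<^sup>2 / 2) \<le> max 1 ((1 + R) ^ N)"
    proof (cases "R \<le> r")
      case True then show ?thesis using R[of r] by simp
    next
      case False
      have "(1 + r) ^ N * exp (- (s * r)\<^sup>2 / 2) \<le> (1 + R) ^ N * 1"
        using False r by (intro mult_mono power_mono) auto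
      then show ?thesis by simp
    qed
  qed
qed

text \<open>Polynomials times one fixed modulated Gaussian. The class is closed under partial
  differentiation, so decay of its members yields decay of all their derivatives.\<close>

inductive gpoly :: "real ^ 'n \<Rightarrow> real \<Rightarrow> (real ^ 'n \<Rightarrow> complex) \<Rightarrow> bool" for a s where
  base: "gpoly a s (\<lambda>\<xi>. cis (a \<bullet> \<xi>) * of_real (exp (- (s * norm \<xi>)\<^sup>2 / 2)))"
| coord: "gpoly a s u \<Longrightarrow> gpoly a s (\<lambda>\<xi>. of_real (\<xi> $ i) * u \<xi>)"
| add: "gpoly a s u \<Longrightarrow> gpoly a s v \<Longrightarrow> gpoly a s (\<lambda>\<xi>. u \<xi> + v \<xi>)"
| cmult: "gpoly a s u \<Longrightarrow> gpoly a s (\<lambda>\<xi>. c * u \<xi>)"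

lemma gpoly_bound:
  fixes a :: "real ^ 'n"
  assumes s: "0 < s" and u: "gpoly a s u"
  shows "\<exists>C. \<forall>x. (1 + norm x) ^ N * norm (u x) \<le> C"
  using u
proof (induction arbitrary: N rule: gpoly.induct)
  case base
  obtain C where "\<forall>r\<ge>0. (1 + r) ^ N * exp (- (s * r)\<^sup>2 / 2) \<le> C" using gaussian_poly_bound[OF s] by blast
  then show ?case by (intro exI[of _ C]) (simp add: norm_mult)
next
  case (coord u i)
  \<comment> \<open>A coordinate factor costs one power of \<open>1 + norm x\<close>; this is why
    the induction is over all \<open>N\<close>.\<close>
  obtain C where C: "\<And>x. (1 + norm x) ^ Suc N * norm (u x) \<le> C" using coord.IH by blast
  show ?case
  proof (intro exI[of _ C] allI)
    fix x :: "real^'n"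
    have "\<bar>x $ i\<bar> * ((1 + norm x) ^ N * norm (u x)) \<le> (1 + norm x) * ((1 + norm x) ^ N * norm (u x))"
      using component_le_norm_cart[of x i] by (intro mult_right_mono) auto
    then show "(1 + norm x) ^ N * norm (of_real (x $ i) * u x) \<le> C"
      using C[of x] by (simp add: norm_mult mult_ac)
  qed
next
  case (add u v)
  obtain C where C: "\<And>x. (1 + norm x) ^ N * norm (u x) \<le> C" using add.IH by blast
  obtain D where D: "\<And>x. (1 + norm x) ^ N * norm (v x) \<le> D" using add.IH by blast
  show ?case
  proof (intro exI[of _ "C + D"] allI)
    fix x :: "real^'n"
    have "(1 + norm x) ^ N * norm (u x + v x) \<le> (1 + norm x) ^ N * (norm (u x) + norm (v x))"
      by (intro mult_left_mono norm_triangle_ineq) auto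
    then show "(1 + norm x) ^ N * norm (u x + v x) \<le> C + D"
      using C[of x] D[of x] by (simp add: distrib_left)
  qed
next
  case (cmult u c)
  obtain C where C: "\<And>x. (1 + norm x) ^ N * norm (u x) \<le> C" using cmult.IH by blast
  show ?case
  proof (intro exI[of _ "norm c * C"] allI)
    fix x :: "real^'n"
    show "(1 + norm x) ^ N * norm (c * u x) \<le> norm c * C"
      using mult_left_mono[OF C[of x], of "norm c"] by (simp add: norm_mult mult_ac)
  qed
qed

text \<open>All partial derivatives are packed into one total derivative, which gives
  differentiability and, evaluated at the basis vectors, \<open>pderiv_dir\<close>.\<close>

lemma gpoly_has_derivative:
  fixes a :: "real ^ 'n"
  assumes u: "gpoly a s u"
  shows "\<exists>v. (\<forall>i. gpoly a s (v i)) \<and> (\<forall>\<xi>. (u has_derivative (\<lambda>h. \<Sum>i\<in>UNIV. of_real (h $ i) * v i \<xi>)) (at \<xi>))"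
  using u
proof (induction rule: gpoly.induct)
  case base
  define u where "u \<xi> = cis (a \<bullet> \<xi>) * of_real (exp (- (s * norm \<xi>)\<^sup>2 / 2))" for \<xi>
  have u: "gpoly a s u" unfolding u_def by (rule gpoly.base)
  \<comment> \<open>The gradient of the exponent i a . xi - s^2 |xi|^2 / 2, times
    \<open>u\<close>.\<close>
  define v where "v i \<xi> = (\<i> * of_real (a $ i)) * u \<xi> + (- of_real (s\<^sup>2)) * (of_real (\<xi> $ i) * u \<xi>)" for i \<xi>
  have "gpoly a s (v i)" for i unfolding v_def by (intro gpoly.add gpoly.cmult gpoly.coord u)
  moreover have "(u has_derivative (\<lambda>h. \<Sum>i\<in>UNIV. of_real (h $ i) * v i \<xi>)) (at \<xi>)" for \<xi>
  proof -
    have ue: "u = (\<lambda>\<xi>. exp (\<i> * of_real (a \<bullet> \<xi>) + of_real (- s\<^sup>2 / 2 * (\<xi> \<bullet> \<xi>))))"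
    proof
      fix \<xi> :: "real ^ 'n"
      have "- (s * norm \<xi>)\<^sup>2 / 2 = - s\<^sup>2 / 2 * (\<xi> \<bullet> \<xi>)" by (simp add: power_mult_distrib power2_norm_eq_inner)
      then show "u \<xi> = exp (\<i> * of_real (a \<bullet> \<xi>) + of_real (- s\<^sup>2 / 2 * (\<xi> \<bullet> \<xi>)))"
        unfolding u_def cis_conv_exp exp_add exp_of_real by simp
    qed
    have d: "((\<lambda>\<xi>. \<i> * of_real (a \<bullet> \<xi>) + of_real (- s\<^sup>2 / 2 * (\<xi> \<bullet> \<xi>)) :: complex) has_derivative
       (\<lambda>h. \<i> * of_real (a \<bullet> h) + of_real (- s\<^sup>2 / 2 * (\<xi> \<bullet> h + h \<bullet> \<xi>)))) (at \<xi>)"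
      by (intro derivative_intros)
    have "(u has_derivative (\<lambda>h. (\<i> * of_real (a \<bullet> h) + of_real (- s\<^sup>2 / 2 * (\<xi> \<bullet> h + h \<bullet> \<xi>))) * u \<xi>)) (at \<xi>)"
    proof -
      define w where "w = \<i> * of_real (a \<bullet> \<xi>) + (of_real (- s\<^sup>2 / 2 * (\<xi> \<bullet> \<xi>)) :: complex)"
      have "(exp has_derivative (\<lambda>z. exp w * z)) (at w)"
        using DERIV_exp[of w] by (simp add: has_field_derivative_def)
      from has_derivative_compose[OF d this[unfolded w_def]] show ?thesis
        unfolding ue by (simp only: mult.commute)
    qed
    also have "(\<lambda>h. (\<i> * of_real (a \<bullet> h) + of_real (- s\<^sup>2 / 2 * (\<xi> \<bullet> h + h \<bullet> \<xi>))) * u \<xi>) =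
        (\<lambda>h. \<Sum>i\<in>UNIV. of_real (h $ i) * v i \<xi>)"
    proof
      fix h :: "real ^ 'n"
      have "(\<Sum>i\<in>UNIV. of_real (h $ i) * v i \<xi>) = (\<Sum>i\<in>UNIV. (\<i> * of_real (a $ i * h $ i) + of_real (- s\<^sup>2 * (\<xi> $ i * h $ i))) * u \<xi>)"
        by (intro sum.cong) (auto simp: v_def algebra_simps)
      also have "\<dots> = (\<i> * of_real (a \<bullet> h) + of_real (- s\<^sup>2 * (\<xi> \<bullet> h))) * u \<xi>"
        by (simp add: inner_vec_def sum_distrib_left sum_distrib_right sum_subtractf left_diff_distrib distrib_right sum_negf)
      also have "- s\<^sup>2 * (\<xi> \<bullet> h) = - s\<^sup>2 / 2 * (\<xi> \<bullet> h + h \<bullet> \<xi>)"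
        by (simp add: inner_commute)
      finally show "(\<i> * of_real (a \<bullet> h) + of_real (- s\<^sup>2 / 2 * (\<xi> \<bullet> h + h \<bullet> \<xi>))) * u \<xi> = (\<Sum>i\<in>UNIV. of_real (h $ i) * v i \<xi>)" ..
    qed
    finally show ?thesis .
  qed
  ultimately show ?case unfolding u_def by blast
next
  case (coord u k)
  then obtain v where v: "\<And>i. gpoly a s (v i)" "\<And>\<xi>. (u has_derivative (\<lambda>h. \<Sum>i\<in>UNIV. of_real (h $ i) * v i \<xi>)) (at \<xi>)"
    by blast
  \<comment> \<open>The product rule; the conditional is the i-th partial derivative of the k-th
    coordinate.\<close>
  define w where "w i \<xi> = (if i = k then 1 else 0) * u \<xi> + of_real (\<xi> $ k) * v i \<xi>" for i \<xi>
  have "gpoly a s (w i)" for i unfolding w_def by (intro gpoly.add gpoly.cmult gpoly.coord coord.hyps v)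
  moreover have "((\<lambda>\<xi>. of_real (\<xi> $ k) * u \<xi>) has_derivative (\<lambda>h. \<Sum>i\<in>UNIV. of_real (h $ i) * w i \<xi>)) (at \<xi>)" for \<xi>
  proof -
    have "((\<lambda>\<xi>. of_real (\<xi> $ k) * u \<xi>) has_derivative
       (\<lambda>h. of_real (\<xi> $ k) * (\<Sum>i\<in>UNIV. of_real (h $ i) * v i \<xi>) + of_real (h $ k) * u \<xi>)) (at \<xi>)"
      by (intro has_derivative_mult v(2) has_derivative_of_real bounded_linear_imp_has_derivative bounded_linear_vec_nth)
    also have "(\<lambda>h. of_real (\<xi> $ k) * (\<Sum>i\<in>UNIV. of_real (h $ i) * v i \<xi>) + of_real (h $ k) * u \<xi>) =
       (\<lambda>h. \<Sum>i\<in>UNIV. of_real (h $ i) * w i \<xi>)"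
    proof
      fix h :: "real ^ 'n"
      have "(\<Sum>i\<in>UNIV. of_real (h $ i) * w i \<xi>) =
        (\<Sum>i\<in>UNIV. (if i = k then of_real (h $ i) * u \<xi> else 0) + of_real (\<xi> $ k) * (of_real (h $ i) * v i \<xi>))"
        by (intro sum.cong) (auto simp: w_def algebra_simps)
      then show "of_real (\<xi> $ k) * (\<Sum>i\<in>UNIV. of_real (h $ i) * v i \<xi>) + of_real (h $ k) * u \<xi> =
        (\<Sum>i\<in>UNIV. of_real (h $ i) * w i \<xi>)"
        by (simp add: sum.distrib sum_distrib_left)
    qed
    finally show ?thesis .
  qed
  ultimately show ?case by blast
next
  case (add u u')
  then obtain v v' where v: "\<And>i. gpoly a s (v i)" "\<And>\<xi>. (u has_derivative (\<lambda>h. \<Sum>i\<in>UNIV. of_real (h $ i) * v i \<xi>)) (at \<xi>)"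
    and v': "\<And>i. gpoly a s (v' i)" "\<And>\<xi>. (u' has_derivative (\<lambda>h. \<Sum>i\<in>UNIV. of_real (h $ i) * v' i \<xi>)) (at \<xi>)"
    by blast
  show ?case
    by (rule exI[of _ "\<lambda>i \<xi>. v i \<xi> + v' i \<xi>"])
      (use has_derivative_add[OF v(2) v'(2)] in \<open>auto simp: distrib_left sum.distrib intro: gpoly.add v v'\<close>)
next
  case (cmult u c)
  then obtain v where v: "\<And>i. gpoly a s (v i)" "\<And>\<xi>. (u has_derivative (\<lambda>h. \<Sum>i\<in>UNIV. of_real (h $ i) * v i \<xi>)) (at \<xi>)"
    by blast
  show ?case
    by (rule exI[of _ "\<lambda>i \<xi>. c * v i \<xi>"])
      (use has_derivative_mult_right[OF v(2), of c] in \<open>auto simp: sum_distrib_left mult.left_commute intro: gpoly.cmult v\<close>)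
qed

lemma gpoly_pderiv_dir:
  assumes "gpoly a s u"
  shows "gpoly a s (pderiv_dir i u)" and "u differentiable (at x)"
proof -
  obtain v where v: "\<And>i. gpoly a s (v i)" "\<And>\<xi>. (u has_derivative (\<lambda>h. \<Sum>i\<in>UNIV. of_real (h $ i) * v i \<xi>)) (at \<xi>)"
    using gpoly_has_derivative[OF assms] by blast
  show "u differentiable (at x)" using v(2) by (auto simp: differentiable_def)
  have "pderiv_dir i u = v i"
  proof
    fix \<xi>
    have "pderiv_dir i u \<xi> = (\<Sum>k\<in>UNIV. of_real (axis i (1::real) $ k) * v k \<xi>)"
      unfolding pderiv_dir_def by (simp flip: frechet_derivative_at[OF v(2)])
    also have "\<dots> = (\<Sum>k\<in>UNIV. if k = i then v k \<xi> else 0)"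
      by (intro sum.cong) (auto simp: axis_def)
    finally show "pderiv_dir i u \<xi> = v i \<xi>" by simp
  qed
  then show "gpoly a s (pderiv_dir i u)" using v(1) by simp
qed

lemma gpoly_schwartz:
  assumes s: "0 < s" and u: "gpoly a s u"
  shows "schwartz u"
  unfolding schwartz_def
proof (intro conjI allI)
  fix k show "C_on k UNIV u"
    using u
  proof (induction k arbitrary: u)
    case 0
    then show ?case
      by (auto intro!: continuous_at_imp_continuous_on differentiable_imp_continuous_within gpoly_pderiv_dir)
  next
    case (Suc k)
    then show ?case using Suc.IH[OF gpoly_pderiv_dir(1)[OF Suc.prems]] gpoly_pderiv_dir(2) by auto
  qed
next
  fix \<beta> N
  have p: "gpoly a s ((pderiv_dir i ^^ m) w)" if "gpoly a s w" for i m w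
    using that by (induction m) (auto intro: gpoly_pderiv_dir)
  \<comment> \<open>The list is arbitrary, so nothing about the enumeration chosen in
    \<open>coords\<close> enters.\<close>
  have "gpoly a s (foldr (\<lambda>i. pderiv_dir i ^^ (\<beta> $ i)) l u)" for l
    using u by (induction l) (auto intro: p)
  then show "\<exists>C. \<forall>x. (1 + norm x) ^ N * norm (mderiv \<beta> u x) \<le> C"
    unfolding mderiv_def using gpoly_bound[OF s] by blast
qed

section \<open>Gaussian integrals\<close>

text \<open>For width 1 this is the characteristic function of the standard normal distribution;
  replacing t by t / s turns the general case into that one with frequency
  \<open>a / s\<close>.\<close>

lemma integral_cis_gaussian_real:
  assumes s: "0 < s"
  shows "integrable lborel (\<lambda>t. cis (a * t) * of_real (exp (- (s * t)\<^sup>2 / 2)))"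
    and "(\<integral>t. cis (a * t) * of_real (exp (- (s * t)\<^sup>2 / 2)) \<partial>lborel) = of_real (sqrt (2 * pi) / s * exp (- (a / s)\<^sup>2 / 2))"
proof -
  have 1: "integrable lborel (\<lambda>t. cis (b * t) * of_real (exp (- t\<^sup>2 / 2)))"
    and 2: "(\<integral>t. cis (b * t) * of_real (exp (- t\<^sup>2 / 2)) \<partial>lborel) = of_real (sqrt (2 * pi) * exp (- b\<^sup>2 / 2))" for b
  proof -
    have e: "cis (b * t) * of_real (exp (- t\<^sup>2 / 2)) = of_real (sqrt (2 * pi)) * (std_normal_density t *\<^sub>R cis (b * t))" for t
      by (simp add: std_normal_density_def scaleR_conv_of_real field_simps)
    have m: "(\<lambda>t. cis (b * t)) \<in> borel_measurable borel"
      by (intro borel_measurable_continuous_onI continuous_intros)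
    have "integrable lborel (\<lambda>t. std_normal_density t *\<^sub>R cis (b * t))"
      by (rule Bochner_Integration.integrable_bound[OF integrable_std_normal_moment[of 0]])
        (use m in auto)
    then show "integrable lborel (\<lambda>t. cis (b * t) * of_real (exp (- t\<^sup>2 / 2)))"
      unfolding e by (rule integrable_mult_right)
    have "(\<integral>t. std_normal_density t *\<^sub>R cis (b * t) \<partial>lborel) = char std_normal_distribution b"
      unfolding char_def by (subst integral_density) (use m in \<open>auto simp: cis_conv_exp\<close>)
    then show "(\<integral>t. cis (b * t) * of_real (exp (- t\<^sup>2 / 2)) \<partial>lborel) = of_real (sqrt (2 * pi) * exp (- b\<^sup>2 / 2))"
      unfolding e integral_mult_right_zero by (simp add: char_std_normal_distribution)
  qed
  let ?f = "\<lambda>t. cis (a * t) * of_real (exp (- (s * t)\<^sup>2 / 2))"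
  have e: "?f (0 + 1 / s * t) = cis (a / s * t) * of_real (exp (- t\<^sup>2 / 2))" for t
    using s by (simp add: field_simps)
  show "integrable lborel ?f"
    using 1[of "a / s"] lborel_integrable_real_affine_iff[of "1 / s" ?f 0] s unfolding e by simp
  show "integral\<^sup>L lborel ?f = of_real (sqrt (2 * pi) / s * exp (- (a / s)\<^sup>2 / 2))"
    using lborel_integral_real_affine[of "1 / s" ?f 0] s unfolding e 2[of "a / s"]
    by (simp add: scaleR_conv_of_real)
qed

lemma integral_cis_gaussian:
  fixes a :: "real ^ 'n"
  assumes s: "0 < s"
  shows "integrable lebesgue (\<lambda>\<xi>. cis (a \<bullet> \<xi>) * of_real (exp (- (s * norm \<xi>)\<^sup>2 / 2)))"
    and "(LINT \<xi>|lebesgue. cis (a \<bullet> \<xi>) * of_real (exp (- (s * norm \<xi>)\<^sup>2 / 2))) =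
      of_real ((sqrt (2 * pi) / s) ^ CARD('n) * exp (- (norm a / s)\<^sup>2 / 2))"
proof -
  have g: "exp (- (c * norm x)\<^sup>2 / 2) = (\<Prod>i\<in>UNIV. exp (- (c * x $ i)\<^sup>2 / 2))" for c and x :: "real ^ 'n"
  proof -
    have "(c * norm x)\<^sup>2 = (\<Sum>i\<in>UNIV. (c * x $ i)\<^sup>2)"
      unfolding power_mult_distrib power2_norm_eq_inner inner_vec_def sum_distrib_left
      by (simp add: power2_eq_square)
    then have "- (c * norm x)\<^sup>2 / 2 = (\<Sum>i\<in>UNIV. - (c * x $ i)\<^sup>2 / 2)"
      by (simp only: sum_negf sum_divide_distrib minus_divide_left[symmetric])
    then show ?thesis by (simp add: exp_sum)
  qed
  have e: "cis (a \<bullet> \<xi>) * of_real (exp (- (s * norm \<xi>)\<^sup>2 / 2)) =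
    (\<Prod>i\<in>UNIV. cis (a $ i * \<xi> $ i) * of_real (exp (- (s * \<xi> $ i)\<^sup>2 / 2)))" for \<xi>
    unfolding cis_inner g prod.distrib of_real_prod ..
  note * = lebesgue_integral_prod[where f="\<lambda>i t. cis (a $ i * t) * of_real (exp (- (s * t)\<^sup>2 / 2))", OF integral_cis_gaussian_real(1)[OF s]]
  show "integrable lebesgue (\<lambda>\<xi>. cis (a \<bullet> \<xi>) * of_real (exp (- (s * norm \<xi>)\<^sup>2 / 2)))"
    unfolding e by (rule *)
  have "(LINT \<xi>|lebesgue. cis (a \<bullet> \<xi>) * of_real (exp (- (s * norm \<xi>)\<^sup>2 / 2))) =
    (\<Prod>i\<in>(UNIV::'n set). of_real (sqrt (2 * pi) / s * exp (- (a $ i / s)\<^sup>2 / 2)))"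
    unfolding e *(2) integral_cis_gaussian_real(2)[OF s] ..
  also have "\<dots> = of_real ((sqrt (2 * pi) / s) ^ CARD('n) * exp (- (norm a / s)\<^sup>2 / 2))"
  proof -
    have "(\<Prod>i\<in>UNIV. exp (- (a $ i / s)\<^sup>2 / 2)) = exp (- (norm a / s)\<^sup>2 / 2)"
      using g[of "1 / s" a] by simp
    then show ?thesis by (simp only: of_real_prod[symmetric] prod.distrib prod_constant)
  qed
  finally show "(LINT \<xi>|lebesgue. cis (a \<bullet> \<xi>) * of_real (exp (- (s * norm \<xi>)\<^sup>2 / 2))) =
      of_real ((sqrt (2 * pi) / s) ^ CARD('n) * exp (- (norm a / s)\<^sup>2 / 2))" .
qed

lemma integrable_poly_gaussian:
  "integrable lebesgue (\<lambda>x::real^'n. (1 + norm x) ^ N * exp (- (norm x)\<^sup>2 / 2))"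
proof -
  \<comment> \<open>With s^2 = 1/2 the Gaussian is the square of the one with parameter
    \<open>s\<close>: one factor absorbs the polynomial, the other remains integrable.\<close>
  define s where "s = 1 / sqrt 2"
  have s: "0 < s" "s\<^sup>2 = 1 / 2" by (auto simp: s_def power_divide)
  obtain C where C: "\<And>r. 0 \<le> r \<Longrightarrow> (1 + r) ^ N * exp (- (s * r)\<^sup>2 / 2) \<le> C" using gaussian_poly_bound[OF s(1)] by blast
  have i: "integrable lebesgue (\<lambda>x::real^'n. C * norm (cis (0 \<bullet> x) * of_real (exp (- (s * norm x)\<^sup>2 / 2))))"
    by (intro integrable_mult_right integrable_norm integral_cis_gaussian s)
  have "(\<lambda>x::real^'n. (1 + norm x) ^ N * exp (- (norm x)\<^sup>2 / 2)) \<in> borel_measurable borel"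
    by (intro borel_measurable_continuous_onI continuous_intros) auto
  then show ?thesis
  proof (intro Bochner_Integration.integrable_bound[OF i])
    have "(1 + r) ^ N * exp (- r\<^sup>2 / 2) \<le> C * exp (- (s * r)\<^sup>2 / 2)" if "0 \<le> r" for r
    proof -
      have "(1 + r) ^ N * exp (- r\<^sup>2 / 2) = (1 + r) ^ N * exp (- (s * r)\<^sup>2 / 2) * exp (- (s * r)\<^sup>2 / 2)"
        by (simp add: mult.assoc power_mult_distrib s flip: exp_add)
      also have "\<dots> \<le> C * exp (- (s * r)\<^sup>2 / 2)" by (intro mult_right_mono C that) simp
      finally show ?thesis .
    qed
    then have "(1 + norm x) ^ N * exp (- (norm x)\<^sup>2 / 2) \<le> C * exp (- (s * norm x)\<^sup>2 / 2)" for x :: "real ^ 'n" by simp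
    moreover have "C * exp (- (s * norm x)\<^sup>2 / 2) \<le> \<bar>C\<bar> * exp (- (s * norm x)\<^sup>2 / 2)" for x :: "real ^ 'n"
      by (intro mult_right_mono) auto
    ultimately have "(1 + norm x) ^ N * exp (- (norm x)\<^sup>2 / 2) \<le> \<bar>C\<bar> * exp (- (s * norm x)\<^sup>2 / 2)" for x :: "real ^ 'n"
      by (rule order_trans)
    then show "AE x in lebesgue. norm ((1 + norm x) ^ N * exp (- (norm x)\<^sup>2 / 2)) \<le> norm (C * norm (cis (0 \<bullet> x) * of_real (exp (- (s * norm (x::real^'n))\<^sup>2 / 2))))"
      by (intro AE_I2) (simp add: abs_mult norm_mult)
  qed (simp add: measurable_completion)
qed

lemma lborel_integral_affine:
  fixes h :: "'a::euclidean_space \<Rightarrow> complex"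
  assumes h: "h \<in> borel_measurable borel" and c: "0 < c"
  shows "(\<integral>x. h x \<partial>lborel) = c ^ DIM('a) *\<^sub>R (\<integral>y. h (t + c *\<^sub>R y) \<partial>lborel)"
proof -
  let ?T = "\<lambda>y::'a. t + c *\<^sub>R y"
  have "(\<integral>x. h x \<partial>lborel) = (\<integral>x. h x \<partial>density (distr lborel borel ?T) (\<lambda>_. ennreal (\<bar>c\<bar> ^ DIM('a))))"
    using lborel_affine[of c t] c by (simp flip: ennreal_power)
  also have "\<dots> = (\<integral>x. (c ^ DIM('a)) *\<^sub>R h x \<partial>distr lborel borel ?T)"
    using c h by (subst integral_density) auto
  also have "\<dots> = (\<integral>y. (c ^ DIM('a)) *\<^sub>R h (?T y) \<partial>lborel)"
    using h by (subst integral_distr) auto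
  finally show ?thesis by simp
qed

text \<open>The result is an approximate identity centred at \<open>a\<close> of width
  \<open>s\<close>, with total mass (2 pi)^(n/2) independent of \<open>s\<close>.\<close>

lemma fourier_gaussian:
  fixes a :: "real ^ 'n"
  assumes s: "0 < s"
  shows "fourier (\<lambda>\<xi>. cis (a \<bullet> \<xi>) * of_real (exp (- (s * norm \<xi>)\<^sup>2 / 2))) x =
    of_real (inverse (s ^ CARD('n)) * exp (- (norm (a - x) / s)\<^sup>2 / 2))"
proof -
  have "(LINT \<xi>|lebesgue. cis (a \<bullet> \<xi>) * of_real (exp (- (s * norm \<xi>)\<^sup>2 / 2)) * exp (- (\<i> * of_real (\<xi> \<bullet> x)))) =
    (LINT \<xi>|lebesgue. cis ((a - x) \<bullet> \<xi>) * of_real (exp (- (s * norm \<xi>)\<^sup>2 / 2)))"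
  proof (rule Bochner_Integration.integral_cong)
    fix \<xi> :: "real ^ 'n"
    have "cis ((a - x) \<bullet> \<xi>) = cis (a \<bullet> \<xi>) * exp (- (\<i> * of_real (\<xi> \<bullet> x)))"
      by (simp add: cis_conv_exp inner_diff_left inner_commute[of x] right_diff_distrib exp_diff exp_minus divide_inverse)
    then show "cis (a \<bullet> \<xi>) * of_real (exp (- (s * norm \<xi>)\<^sup>2 / 2)) * exp (- (\<i> * of_real (\<xi> \<bullet> x))) =
      cis ((a - x) \<bullet> \<xi>) * of_real (exp (- (s * norm \<xi>)\<^sup>2 / 2))" by simp
  qed simp
  moreover have "(2 * pi) powr (- real CARD('n) / 2) * (sqrt (2 * pi)) ^ CARD('n) = 1"
    by (simp add: powr_half_sqrt[symmetric] powr_powr flip: powr_realpow powr_add)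
  then have "(2 * pi) powr (- real CARD('n) / 2) * (sqrt (2 * pi) / s) ^ CARD('n) = inverse (s ^ CARD('n))"
    by (simp add: power_divide field_simps)
  ultimately show ?thesis
    unfolding fourier_def integral_cis_gaussian(2)[OF s]
    by (metis (no_types, lifting) mult.assoc of_real_mult)
qed

section \<open>The inversion formula\<close>

lemma continuous_borel_measurable_lebesgue:
  fixes f :: "real ^ 'n \<Rightarrow> 'b::topological_space"
  shows "continuous_on UNIV f \<Longrightarrow> f \<in> borel_measurable lebesgue"
  by (intro measurable_completion) (simp add: borel_measurable_continuous_onI)

text \<open>As \<open>s\<close> tends to 0, the Gaussian factor tends to 1 on the side of
  \<open>F\<close>, while on the side of \<open>f\<close> the mass concentrates at \<open>a\<close>.
  Continuity of \<open>f\<close> makes the formula hold at every point and not merely almost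
  everywhere.\<close>

lemma fourier_inversion:
  fixes f F :: "real ^ 'n \<Rightarrow> complex"
  assumes f: "continuous_on UNIV f" and si: "slowly_increasing f"
    and gv: "given_on UNIV (fourier_distr (distr_of f)) F" and F: "integrable lebesgue F"
  shows "f a = fourier_inv F a"
proof -
  define \<psi> where "\<psi> s \<xi> = cis (a \<bullet> \<xi>) * of_real (exp (- (s * norm \<xi>)\<^sup>2 / 2))" for s and \<xi> :: "real ^ 'n"
  define G where "G y = exp (- (norm y)\<^sup>2 / 2)" for y :: "real ^ 'n"
  have id: "(LINT \<xi>|lebesgue. F \<xi> * \<psi> s \<xi>) = (LINT y|lebesgue. f (a + s *\<^sub>R y) * of_real (G y))" if s: "0 < s" for s
  proof -
    have "schwartz (\<psi> s)" unfolding \<psi>_def by (rule gpoly_schwartz[OF s gpoly.base])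
    then have "(LINT \<xi>|lebesgue. F \<xi> * \<psi> s \<xi>) = (LINT x|lebesgue. f x * fourier (\<psi> s) x)"
      using gv unfolding given_on_def fourier_distr_def distr_of_def by simp
    also have "\<dots> = (LINT x|lebesgue. f x * of_real (inverse (s ^ CARD('n)) * exp (- (norm (a - x) / s)\<^sup>2 / 2)))"
      unfolding \<psi>_def fourier_gaussian[OF s] ..
    also have "\<dots> = (LINT x|lborel. f x * of_real (inverse (s ^ CARD('n)) * exp (- (norm (a - x) / s)\<^sup>2 / 2)))"
      by (intro integral_completion) (use s in \<open>simp add: f borel_measurable_continuous_onI continuous_intros\<close>)
    \<comment> \<open>Substituting x = a + s y moves the dependence on \<open>s\<close> from the
      Gaussian into the argument of \<open>f\<close>.\<close>
    also have "\<dots> = s ^ CARD('n) *\<^sub>R (LINT y|lborel. f (a + s *\<^sub>R y) * of_real (inverse (s ^ CARD('n)) * exp (- (norm (a - (a + s *\<^sub>R y)) / s)\<^sup>2 / 2)))"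
      by (subst lborel_integral_affine[OF _ s, of _ a]) (use s in \<open>simp_all add: f borel_measurable_continuous_onI continuous_intros\<close>)
    also have "\<dots> = (LINT y|lborel. f (a + s *\<^sub>R y) * of_real (G y))"
      unfolding integral_scaleR_right[symmetric]
    proof (rule Bochner_Integration.integral_cong)
      fix y
      have "norm (a - (a + s *\<^sub>R y)) / s = norm y" using s by simp
      then show "s ^ CARD('n) *\<^sub>R (f (a + s *\<^sub>R y) * of_real (inverse (s ^ CARD('n)) * exp (- (norm (a - (a + s *\<^sub>R y)) / s)\<^sup>2 / 2))) =
        f (a + s *\<^sub>R y) * of_real (G y)"
        using s by (simp only: G_def) (simp add: scaleR_conv_of_real field_simps)
    qed simp
    also have "\<dots> = (LINT y|lebesgue. f (a + s *\<^sub>R y) * of_real (G y))"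
    proof (rule integral_completion[symmetric])
      have "continuous_on UNIV (\<lambda>y. f (a + s *\<^sub>R y))"
        by (rule continuous_on_compose2[OF f]) (auto intro!: continuous_intros)
      then have "continuous_on UNIV (\<lambda>y. f (a + s *\<^sub>R y) * of_real (G y))"
        unfolding G_def by (intro continuous_intros) auto
      then show "(\<lambda>y. f (a + s *\<^sub>R y) * of_real (G y)) \<in> borel_measurable lborel"
        by (simp add: borel_measurable_continuous_onI)
    qed
    finally show ?thesis .
  qed
  define s where "s n = inverse (real (Suc n))" for n
  have s0: "s \<longlonglongrightarrow> 0" unfolding s_def by (rule LIMSEQ_inverse_real_of_nat)
  have sp: "0 < s n" "s n \<le> 1" for n by (auto simp: s_def inverse_le_1_iff)
  have Fm: "F \<in> borel_measurable lebesgue" using F by (rule borel_measurable_integrable)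
  have \<psi>m: "\<psi> s \<in> borel_measurable lebesgue" for s
    unfolding \<psi>_def by (intro continuous_borel_measurable_lebesgue continuous_intros) auto
  have \<psi>1: "norm (\<psi> s \<xi>) \<le> 1" for s \<xi> by (simp add: \<psi>_def norm_mult)
  have L: "(\<lambda>n. LINT \<xi>|lebesgue. F \<xi> * \<psi> (s n) \<xi>) \<longlonglongrightarrow> (LINT \<xi>|lebesgue. F \<xi> * cis (a \<bullet> \<xi>))"
  proof (rule integral_dominated_convergence[where w="\<lambda>\<xi>. norm (F \<xi>)"])
    have "(\<lambda>n. F \<xi> * \<psi> (s n) \<xi>) \<longlonglongrightarrow> F \<xi> * (cis (a \<bullet> \<xi>) * of_real (exp (- (0 * norm \<xi>)\<^sup>2 / 2)))" for \<xi>
      unfolding \<psi>_def by (intro tendsto_intros s0) auto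
    then show "AE \<xi> in lebesgue. (\<lambda>n. F \<xi> * \<psi> (s n) \<xi>) \<longlonglongrightarrow> F \<xi> * cis (a \<bullet> \<xi>)" by simp
    show "AE \<xi> in lebesgue. norm (F \<xi> * \<psi> (s n) \<xi>) \<le> norm (F \<xi>)" for n
      using \<psi>1 by (intro AE_I2) (simp add: norm_mult mult_left_le)
    show "(\<lambda>\<xi>. F \<xi> * cis (a \<bullet> \<xi>)) \<in> borel_measurable lebesgue"
      by (intro borel_measurable_times Fm continuous_borel_measurable_lebesgue continuous_intros)
    show "(\<lambda>\<xi>. F \<xi> * \<psi> (s n) \<xi>) \<in> borel_measurable lebesgue" for n
      by (intro borel_measurable_times Fm \<psi>m)
  qed (use F in simp)
  obtain C N where C: "\<And>x. norm (f x) \<le> C * (1 + norm x) ^ N" using si unfolding slowly_increasing_def by blast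
  have C0: "0 \<le> C" using order_trans[OF norm_ge_zero C[of 0]] by simp
  \<comment> \<open>As the widths are at most 1, 1 + |a + s y| is at most (1 + |a|) (1 + |y|), which
    gives one integrable majorant for all \<open>n\<close>.\<close>
  have bound: "norm (f (a + s n *\<^sub>R y)) \<le> C * (1 + norm a) ^ N * (1 + norm y) ^ N" for n y
  proof -
    have "norm (a + s n *\<^sub>R y) \<le> norm a + s n * norm y"
      using norm_triangle_ineq[of a "s n *\<^sub>R y"] sp(1)[of n] by simp
    also have "\<dots> \<le> norm a + 1 * norm y" by (intro add_left_mono mult_right_mono sp) auto
    finally have "norm (a + s n *\<^sub>R y) \<le> norm a + norm y" by simp
    moreover have "(1 + norm a) * (1 + norm y) = 1 + norm a + norm y + norm a * norm y" by (simp add: algebra_simps)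
    moreover have "0 \<le> norm a * norm y" by simp
    ultimately have "1 + norm (a + s n *\<^sub>R y) \<le> (1 + norm a) * (1 + norm y)" by linarith
    then have "(1 + norm (a + s n *\<^sub>R y)) ^ N \<le> ((1 + norm a) * (1 + norm y)) ^ N" by (intro power_mono) auto
    then have "C * (1 + norm (a + s n *\<^sub>R y)) ^ N \<le> C * ((1 + norm a) * (1 + norm y)) ^ N" by (intro mult_left_mono C0)
    with C[of "a + s n *\<^sub>R y"] show ?thesis by (simp add: power_mult_distrib mult_ac)
  qed
  have R: "(\<lambda>n. LINT y|lebesgue. f (a + s n *\<^sub>R y) * of_real (G y)) \<longlonglongrightarrow> (LINT y|lebesgue. f a * of_real (G y))"
  proof (rule integral_dominated_convergence[where w="\<lambda>y. C * (1 + norm a) ^ N * ((1 + norm y) ^ N * G y)"])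
    have Gc: "continuous_on UNIV G" unfolding G_def by (intro continuous_intros) auto
    then show "(\<lambda>y. f a * of_real (G y)) \<in> borel_measurable lebesgue"
      by (intro continuous_borel_measurable_lebesgue continuous_intros)
    have "continuous_on UNIV (\<lambda>y. f (a + s n *\<^sub>R y))" for n
      by (rule continuous_on_compose2[OF f]) (auto intro!: continuous_intros)
    then show "(\<lambda>y. f (a + s n *\<^sub>R y) * of_real (G y)) \<in> borel_measurable lebesgue" for n
      using Gc by (intro continuous_borel_measurable_lebesgue continuous_intros)
    show "integrable lebesgue (\<lambda>y. C * (1 + norm a) ^ N * ((1 + norm y) ^ N * G y))"
      unfolding G_def by (intro integrable_mult_right integrable_poly_gaussian)
    have "isCont f a" using f by (simp add: continuous_on_eq_continuous_at)
    moreover have "(\<lambda>n. a + s n *\<^sub>R y) \<longlonglongrightarrow> a + 0 *\<^sub>R y" for y by (intro tendsto_intros s0)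
    ultimately have "(\<lambda>n. f (a + s n *\<^sub>R y)) \<longlonglongrightarrow> f a" for y by (auto intro: isCont_tendsto_compose)
    then show "AE y in lebesgue. (\<lambda>n. f (a + s n *\<^sub>R y) * of_real (G y)) \<longlonglongrightarrow> f a * of_real (G y)"
      by (intro AE_I2 tendsto_intros)
    show "AE y in lebesgue. norm (f (a + s n *\<^sub>R y) * of_real (G y)) \<le> C * (1 + norm a) ^ N * ((1 + norm y) ^ N * G y)" for n
    proof (rule AE_I2)
      fix y
      have "norm (f (a + s n *\<^sub>R y)) * G y \<le> C * (1 + norm a) ^ N * (1 + norm y) ^ N * G y"
        by (intro mult_right_mono bound) (simp add: G_def)
      then show "norm (f (a + s n *\<^sub>R y) * of_real (G y)) \<le> C * (1 + norm a) ^ N * ((1 + norm y) ^ N * G y)"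
        by (simp add: norm_mult G_def mult_ac)
    qed
  qed
  have "(LINT y|lebesgue. of_real (G y)) = (of_real (sqrt (2 * pi) ^ CARD('n)) :: complex)"
    using integral_cis_gaussian(2)[of 1 "0 :: real ^ 'n"] by (simp add: G_def)
  then have "(LINT y|lebesgue. f a * of_real (G y)) = f a * of_real (sqrt (2 * pi) ^ CARD('n))"
    by (simp del: integral_complex_of_real)
  moreover have "(LINT y|lebesgue. f a * of_real (G y)) = (LINT \<xi>|lebesgue. F \<xi> * cis (a \<bullet> \<xi>))"
    using LIMSEQ_unique[OF R L[unfolded id[OF sp(1)]]] .
  ultimately have "(LINT \<xi>|lebesgue. F \<xi> * cis (a \<bullet> \<xi>)) = f a * of_real (sqrt (2 * pi) ^ CARD('n))"
    by (metis (no_types, lifting))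
  moreover have "(2 * pi) powr (- real CARD('n) / 2) * (sqrt (2 * pi)) ^ CARD('n) = 1"
    by (simp add: powr_half_sqrt[symmetric] powr_powr flip: powr_realpow powr_add)
  then have "of_real ((2 * pi) powr (- real CARD('n) / 2)) * (f a * of_real (sqrt (2 * pi) ^ CARD('n))) = f a"
    by (metis mult.left_commute mult.right_neutral of_real_1 of_real_mult)
  ultimately show ?thesis unfolding fourier_inv_def cis_conv_exp by simp
qed

section \<open>Periodization of the fundamental function\<close>

lemma cis_lat_per: "cis (lat j \<bullet> per m) = 1"
proof -
  have "lat j \<bullet> lat m = of_int (\<Sum>i\<in>UNIV. j $ i * m $ i)" by (simp add: lat_def inner_vec_def)
  then obtain k :: int where "lat j \<bullet> lat m = of_int k" by blast
  then show ?thesis using cis_multiple_2pi[of "of_int k"] by simp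
qed

lemma bij_per_shift: "bij_betw (\<lambda>j::int^'n. m + j) UNIV UNIV"
  by (rule bij_betwI[of _ _ _ "\<lambda>j. j - m"]) auto

text \<open>A subset of full measure on which every lattice translate avoids the origin, so that the
  arbitrary value of the transform there never enters.\<close>

definition punctured_cube :: "(real ^ 'n) set" where
  "punctured_cube = {\<xi>. \<xi> \<noteq> 0 \<and> (\<forall>i. - pi < \<xi> $ i \<and> \<xi> $ i < pi)}"

lemma punctured_cube_subset: "\<xi> \<in> punctured_cube \<Longrightarrow> \<xi> \<in> cube - {0}"
  by (auto simp: punctured_cube_def cube_def less_imp_le)

lemma AE_punctured_cube: "AE \<xi> in cubeM. \<xi> \<in> (punctured_cube :: (real^'n) set)"
proof -
  have "AE \<xi> in lebesgue. \<xi> \<noteq> (0 :: real^'n)"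
    using AE_not_in[of "{0 :: real^'n}" lebesgue] by (simp add: countable_imp_null_set_lborel)
  then have "AE \<xi> in lebesgue. \<xi> \<in> cube \<longrightarrow> \<xi> \<in> (punctured_cube :: (real^'n) set)"
    using AE_cube_interior by eventually_elim (simp add: punctured_cube_def)
  then show ?thesis by (simp add: AE_restrict_space_iff)
qed

lemma punctured_cube_shift: "\<xi> \<in> punctured_cube \<Longrightarrow> \<xi> + per m \<noteq> 0"
proof
  assume g: "\<xi> \<in> punctured_cube" and z: "\<xi> + per m = 0"
  have "m $ i = 0" for i
  proof -
    have "\<xi> $ i + 2 * pi * of_int (m $ i) = 0" using z by (simp add: vec_eq_iff lat_def)
    moreover have "- pi < \<xi> $ i" "\<xi> $ i < pi" using g by (auto simp: punctured_cube_def)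
    ultimately have "2 * pi * of_int (m $ i) < 2 * pi * 1" "2 * pi * (-1) < 2 * pi * of_int (m $ i)"
      using pi_gt_zero by linarith+
    moreover have "0 < 2 * pi" by simp
    ultimately have "real_of_int (m $ i) < 1" "-1 < real_of_int (m $ i)"
      using mult_less_cancel_left_pos by blast+
    then show ?thesis by linarith
  qed
  then have "m = 0" by (simp add: vec_eq_iff)
  with z g show False by (simp add: lat_simps punctured_cube_def)
qed

section \<open>Weights of a single interpolator\<close>

text \<open>The part of the hypotheses on one member of the family that the argument consumes, with
  a majorant \<open>b\<close> that can be shared by all members. At index 0 the ratio is 1, whence
  \<open>b 0 = 1\<close>.\<close>

locale symbol =
  fixes \<Phi> :: "real ^ 'n \<Rightarrow> real" and b :: "int ^ 'n \<Rightarrow> real"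
  assumes nonneg: "\<xi> \<noteq> 0 \<Longrightarrow> 0 \<le> \<Phi> \<xi>"
    and pos: "\<xi> \<in> cube - {0} \<Longrightarrow> 0 < \<Phi> \<xi>"
    and cont: "continuous_on (- {0}) \<Phi>"
    and b_summable: "b summable_on UNIV"
    and b_nonneg: "0 \<le> b m" and b_0: "b 0 = 1"
    and ratio: "m \<noteq> 0 \<Longrightarrow> \<xi> \<in> cube - {0} \<Longrightarrow> Mratio \<Phi> m \<xi> \<le> b m"
begin

definition S :: "real ^ 'n \<Rightarrow> real" where "S \<xi> = (\<Sum>\<^sub>\<infinity>j. \<Phi> (\<xi> + per j))"

definition w :: "int ^ 'n \<Rightarrow> real ^ 'n \<Rightarrow> real" where "w m \<xi> = \<Phi> (\<xi> + per m) / S \<xi>"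

definition c :: real where "c = (2 * pi) powr (- real CARD('n) / 2)"

lemma c_pos: "0 < c" by (simp add: c_def)

text \<open>One \<open>c\<close> comes from the samples of f_k, one from the values of L, and the
  volume from Parseval's identity with unnormalised coefficients.\<close>

lemma c_sq: "c * c * (2 * pi) ^ CARD('n) = 1"
proof -
  have "(2 * pi) ^ CARD('n) = (2 * pi) powr real CARD('n)" by (rule powr_realpow[symmetric]) simp
  then show ?thesis unfolding c_def by (simp only: powr_add[symmetric]) simp
qed

lemma \<Phi>_le: assumes \<xi>: "\<xi> \<in> punctured_cube" shows "\<Phi> (\<xi> + per m) \<le> b m * \<Phi> \<xi>"
proof (cases "m = 0")
  case False
  have "\<Phi> (\<xi> + per m) / \<Phi> \<xi> \<le> b m" using ratio[OF False punctured_cube_subset[OF \<xi>]] by (simp add: Mratio_def)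
  then show ?thesis using pos[OF punctured_cube_subset[OF \<xi>]] by (simp add: divide_le_eq)
qed (simp add: lat_simps b_0)

lemma \<Phi>_shift_nonneg: "\<xi> \<in> punctured_cube \<Longrightarrow> 0 \<le> \<Phi> (\<xi> + per m)"
  by (intro nonneg punctured_cube_shift)

lemma \<Phi>_summable: assumes \<xi>: "\<xi> \<in> punctured_cube" shows "(\<lambda>m. \<Phi> (\<xi> + per m)) summable_on UNIV"
  by (rule summable_on_comparison_test[OF summable_on_cmult_left[OF b_summable, of "\<Phi> \<xi>"]])
    (use \<Phi>_le[OF \<xi>] \<Phi>_shift_nonneg[OF \<xi>] in auto)

lemma S_ge: assumes \<xi>: "\<xi> \<in> punctured_cube" shows "\<Phi> \<xi> \<le> S \<xi>" and "0 < S \<xi>"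
proof -
  have "sum (\<lambda>m. \<Phi> (\<xi> + per m)) {0} \<le> S \<xi>"
    unfolding S_def by (rule finite_sum_le_infsum[OF \<Phi>_summable[OF \<xi>]]) (use \<Phi>_shift_nonneg[OF \<xi>] in auto)
  then show "\<Phi> \<xi> \<le> S \<xi>" by (simp add: lat_simps)
  then show "0 < S \<xi>" using pos[OF punctured_cube_subset[OF \<xi>]] by linarith
qed

text \<open>Reindexing along a bijection is valid for \<open>infsum\<close> whether or not the sum
  converges, so the identity holds at every point.\<close>

lemma S_shift: "S (\<xi> + per m) = S \<xi>"
  using infsum_reindex_bij_betw[OF bij_per_shift, of "\<lambda>j. \<Phi> (\<xi> + per j)" m]
  by (simp add: S_def lat_simps scaleR_add_right add.assoc)

lemma Lhat_shift: "Lhat \<Phi> (\<xi> + per m) = c * w m \<xi>"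
  unfolding Lhat_def c_def[symmetric] S_def[symmetric] S_shift w_def ..

lemma w_nonneg: "\<xi> \<in> punctured_cube \<Longrightarrow> 0 \<le> w m \<xi>"
  unfolding w_def using \<Phi>_shift_nonneg S_ge(2) by (simp add: less_imp_le)

lemma w_has_sum: assumes \<xi>: "\<xi> \<in> punctured_cube" shows "((\<lambda>m. w m \<xi>) has_sum 1) UNIV"
proof -
  have "((\<lambda>m. \<Phi> (\<xi> + per m) * inverse (S \<xi>)) has_sum S \<xi> * inverse (S \<xi>)) UNIV"
    unfolding S_def by (intro has_sum_cmult_left has_sum_infsum \<Phi>_summable \<xi>)
  then show ?thesis using S_ge(2)[OF \<xi>] by (simp add: w_def divide_inverse)
qed

lemma w_le_Mratio: assumes \<xi>: "\<xi> \<in> punctured_cube" shows "w m \<xi> \<le> Mratio \<Phi> m \<xi>"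
  unfolding w_def Mratio_def using \<Phi>_shift_nonneg[OF \<xi>] S_ge[OF \<xi>] pos[OF punctured_cube_subset[OF \<xi>]]
  by (intro divide_left_mono) auto

lemma w_le_b: assumes \<xi>: "\<xi> \<in> punctured_cube" shows "w m \<xi> \<le> b m"
proof (cases "m = 0")
  case True
  then show ?thesis using S_ge[OF \<xi>] by (simp add: b_0 w_def lat_simps)
next
  case False
  then show ?thesis using w_le_Mratio[OF \<xi>, of m] ratio[OF False punctured_cube_subset[OF \<xi>]] by linarith
qed

lemma \<Phi>_measurable: "\<Phi> \<in> borel_measurable lebesgue"
proof (rule borel_measurable_AE)
  have "(\<lambda>x. indicator (- {0}) x *\<^sub>R \<Phi> x) \<in> borel_measurable borel"
    by (intro borel_measurable_continuous_on_indicator cont) auto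
  then show "(\<lambda>x. indicator (- {0}) x *\<^sub>R \<Phi> x) \<in> borel_measurable lebesgue"
    by (intro measurable_completion) simp
  have "AE x in lebesgue. x \<noteq> (0 :: real^'n)"
    using AE_not_in[of "{0 :: real^'n}" lebesgue] by (simp add: countable_imp_null_set_lborel)
  then show "AE x in lebesgue. indicator (- {0}) x *\<^sub>R \<Phi> x = \<Phi> x"
    by eventually_elim simp
qed

lemma \<Phi>_shift_measurable: "(\<lambda>\<xi>. \<Phi> (\<xi> + t)) \<in> borel_measurable lebesgue"
  using lebesgue_integral_translation(3)[OF \<Phi>_measurable, of t] by (simp add: add.commute)

text \<open>In case of divergence both \<open>infsum\<close> and \<open>enn2real\<close> give the junk value \<open>0\<close>, so that
  summability need not be known here.\<close>

lemma S_measurable: "S \<in> borel_measurable lebesgue"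
proof -
  define e :: "nat \<Rightarrow> int ^ 'n" where "e = from_nat_into UNIV"
  have e: "bij_betw e UNIV UNIV"
    unfolding e_def using infinite_int_vec by (intro bij_betw_from_nat_into) auto
  show ?thesis
  proof (rule borel_measurable_AE)
    show "(\<lambda>\<xi>. enn2real (\<Sum>n. ennreal (\<Phi> (\<xi> + per (e n))))) \<in> borel_measurable lebesgue"
      using \<Phi>_shift_measurable by measurable
    have "range (\<lambda>m::int^'n. - per m) \<in> null_sets lborel"
      by (intro countable_imp_null_set_lborel) auto
    then have "AE \<xi> in lebesgue. \<xi> \<notin> range (\<lambda>m::int^'n. - per m)"
      by (intro AE_completion AE_not_in)
    then show "AE \<xi> in lebesgue. enn2real (\<Sum>n. ennreal (\<Phi> (\<xi> + per (e n)))) = S \<xi>"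
    proof eventually_elim
      case (elim \<xi>)
      have "\<xi> + per m \<noteq> 0" for m using elim by (auto simp: add_eq_0_iff2)
      then have nn: "0 \<le> \<Phi> (\<xi> + per m)" for m by (rule nonneg)
      have Se: "S \<xi> = (\<Sum>\<^sub>\<infinity>n. \<Phi> (\<xi> + per (e n)))"
        unfolding S_def by (rule infsum_reindex_bij_betw[OF e, symmetric])
      show ?case
      proof (cases "summable (\<lambda>n. \<Phi> (\<xi> + per (e n)))")
        case True
        then have "((\<lambda>n. \<Phi> (\<xi> + per (e n))) has_sum (\<Sum>n. \<Phi> (\<xi> + per (e n)))) UNIV"
          by (intro sums_nonneg_imp_has_sum nn summable_sums)
        then have "S \<xi> = (\<Sum>n. \<Phi> (\<xi> + per (e n)))" unfolding Se by (rule infsumI)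
        then show ?thesis using suminf_ennreal2[OF nn True] suminf_nonneg[OF True nn] by simp
      next
        case False
        then have "\<not> (\<lambda>n. \<Phi> (\<xi> + per (e n))) summable_on UNIV" using summable_on_imp_summable by blast
        then have "S \<xi> = 0" unfolding Se by (rule infsum_not_exists)
        moreover have "(\<Sum>n. ennreal (\<Phi> (\<xi> + per (e n)))) = top"
          using False summable_suminf_not_top[of "\<lambda>n. \<Phi> (\<xi> + per (e n))"] nn by blast
        ultimately show ?thesis by simp
      qed
    qed
  qed
qed

lemma w_measurable: "w m \<in> borel_measurable lebesgue"
  unfolding w_def[abs_def] using \<Phi>_shift_measurable S_measurable by measurable

lemma Lhat_measurable: "Lhat \<Phi> \<in> borel_measurable lebesgue"
proof -
  have "Lhat \<Phi> = (\<lambda>\<xi>. c * w 0 \<xi>)" using Lhat_shift[of _ 0] by (auto simp: lat_simps)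
  then show ?thesis using w_measurable by simp
qed

section \<open>The periodized function with the values of L as coefficients\<close>

text \<open>For fixed \<open>x\<close> this is the periodization of \<open>Lhat \<Phi>\<close> times
  the character of \<open>x\<close>. It is written as a series over an enumeration to make
  measurability immediate; \<open>P_has_sum\<close> recovers the unordered sum.\<close>

definition P :: "real ^ 'n \<Rightarrow> real ^ 'n \<Rightarrow> complex" where
  "P x \<xi> = (\<Sum>n. of_real (c * w (from_nat_into UNIV n) \<xi>) * cis (x \<bullet> (\<xi> + per (from_nat_into UNIV n))))"

lemma cis_measurable: "(\<lambda>\<xi>::real^'n. cis (x \<bullet> (\<xi> + t))) \<in> borel_measurable lebesgue"
  by (intro continuous_borel_measurable_lebesgue continuous_intros)

lemma P_measurable: "P x \<in> borel_measurable lebesgue"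
  unfolding P_def[abs_def] using w_measurable cis_measurable by measurable

lemma P_has_sum:
  assumes \<xi>: "\<xi> \<in> punctured_cube"
  shows "((\<lambda>m. of_real (c * w m \<xi>) * cis (x \<bullet> (\<xi> + per m))) has_sum P x \<xi>) UNIV"
proof -
  have e: "bij_betw (from_nat_into (UNIV :: (int ^ 'n) set)) UNIV UNIV"
    using infinite_int_vec by (intro bij_betw_from_nat_into) auto
  let ?u = "\<lambda>m. of_real (c * w m \<xi>) * cis (x \<bullet> (\<xi> + per m))"
  have "(\<lambda>m. norm (?u m)) summable_on UNIV"
    using has_sum_imp_summable[OF has_sum_cmult_right[OF w_has_sum[OF \<xi>], of c]] c_pos w_nonneg[OF \<xi>]
    by (simp add: norm_mult abs_mult)
  then have "?u summable_on UNIV" by (rule abs_summable_summable)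
  then obtain T where T: "(?u has_sum T) UNIV" by (auto simp: summable_on_def)
  then have "((\<lambda>n. ?u (from_nat_into UNIV n)) has_sum T) UNIV"
    using has_sum_reindex_bij_betw[OF e, of ?u T] by simp
  then have "P x \<xi> = T" unfolding P_def by (simp add: has_sum_imp_sums sums_unique[symmetric])
  with T show ?thesis by simp
qed

lemma P_norm: "\<xi> \<in> punctured_cube \<Longrightarrow> norm (P x \<xi>) \<le> c"
  by (rule norm_infsum_le[OF P_has_sum has_sum_cmult_right[OF w_has_sum, of _ c, unfolded mult_1_right]])
    (use c_pos w_nonneg in \<open>auto simp: norm_mult abs_mult\<close>)

lemma ebdd_P: "ebdd (P x)"
proof (rule ebddI)
  show "P x \<in> borel_measurable cubeM" by (intro measurable_restrict_space1 P_measurable)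
  show "AE \<xi> in cubeM. norm (P x \<xi>) \<le> c" using AE_punctured_cube by eventually_elim (rule P_norm)
qed

text \<open>The integers \<open>j . m\<close> make \<open>cis (lat j \<bullet> per m)\<close> equal
  to 1, so the factor with \<open>j\<close> is common to all translates. The same family of
  integrals is then summed twice, by tiling and by termwise integration.\<close>

lemma Lfun_eq_coef: "Lfun \<Phi> (x - lat j) = of_real c * coef (P x) j"
proof -
  interpret finite_measure "cubeM :: (real^'n) measure" by (rule finite_measure_cube)
  define G where "G \<xi> = complex_of_real (Lhat \<Phi> \<xi>) * cis ((x - lat j) \<bullet> \<xi>)" for \<xi>
  define g where "g m \<xi> = (of_real (c * w m \<xi>) * cis (x \<bullet> (\<xi> + per m))) * cis (- (lat j \<bullet> \<xi>))" for m \<xi>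
  have Gg: "G (\<xi> + per m) = g m \<xi>" for m \<xi>
  proof -
    have "cis ((x - lat j) \<bullet> (\<xi> + per m)) = cis (x \<bullet> (\<xi> + per m)) * cis (- (lat j \<bullet> \<xi>)) * cnj (cis (lat j \<bullet> per m))"
      unfolding cis_cnj cis_mult by (simp only: inner_diff_left inner_add_right) (simp add: algebra_simps)
    then show ?thesis unfolding cis_lat_per by (simp add: G_def g_def Lhat_shift)
  qed
  have Gm: "G \<in> borel_measurable lebesgue"
    unfolding G_def using Lhat_measurable cis_measurable[of "x - lat j" 0] by simp
  have gm: "g m \<in> borel_measurable cubeM" for m
    unfolding g_def using w_measurable cis_measurable[of x "per m"] cis_measurable[of "- lat j" 0]
    by (intro measurable_restrict_space1) simp
  have gb: "AE \<xi> in cubeM. norm (g m \<xi>) \<le> c * b m" for m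
    using AE_punctured_cube
  proof eventually_elim
    case (elim \<xi>)
    show ?case using w_le_b[OF elim, of m] w_nonneg[OF elim, of m] c_pos by (simp add: g_def norm_mult abs_mult)
  qed
  have cb: "(\<lambda>m. c * b m) summable_on UNIV" by (intro summable_on_cmult_right b_summable)
  have 1: "((\<lambda>m. LINT \<xi>|cubeM. g m \<xi>) has_sum (LINT \<xi>|lebesgue. G \<xi>)) UNIV"
    using tile_integral(2)[OF Gm _ cb] gb by (simp add: Gg)
  have "AE \<xi> in cubeM. ((\<lambda>m. g m \<xi>) has_sum P x \<xi> * cis (- (lat j \<bullet> \<xi>))) UNIV"
    using AE_punctured_cube by eventually_elim (unfold g_def, intro has_sum_cmult_left P_has_sum)
  from integral_has_sum_bounded(2)[OF infinite_int_vec gm _ this gb cb]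
  have "((\<lambda>m. LINT \<xi>|cubeM. g m \<xi>) has_sum coef (P x) j) UNIV"
    using ebdd_coef[OF ebdd_P] by (simp add: coef_def ebdd_def)
  with 1 have "(LINT \<xi>|lebesgue. G \<xi>) = coef (P x) j" by (rule has_sum_unique)
  then show ?thesis
    unfolding Lfun_def fourier_inv_def c_def G_def cis_conv_exp by simp
qed

text \<open>The defect of the central weight is counted once for the term m = 0 and once as the
  total weight of all the others.\<close>

lemma P_error:
  assumes \<xi>: "\<xi> \<in> punctured_cube"
  shows "norm (of_real c * cis (x \<bullet> \<xi>) - P x \<xi>) \<le> 2 * c * (1 - w 0 \<xi>)"
proof -
  have z: "((\<lambda>m. if m = 0 then v else 0) has_sum v) UNIV" for v :: "'b::real_normed_vector"
    by (rule has_sum_finite_neutralI[of "{0}"]) auto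
  let ?u = "\<lambda>m. of_real (c * w m \<xi>) * cis (x \<bullet> (\<xi> + per m))"
  have 1: "((\<lambda>m. ?u m + - (if m = 0 then ?u 0 else 0)) has_sum P x \<xi> + - ?u 0) UNIV"
    by (intro has_sum_add has_sum_uminusI P_has_sum \<xi> z)
  have 2: "((\<lambda>m. c * (w m \<xi> + - (if m = 0 then w 0 \<xi> else 0))) has_sum c * (1 + - w 0 \<xi>)) UNIV"
    by (intro has_sum_cmult_right has_sum_add has_sum_uminusI w_has_sum \<xi> z)
  have a: "norm (P x \<xi> + - ?u 0) \<le> c * (1 + - w 0 \<xi>)"
    by (rule norm_infsum_le[OF 1 2]) (use c_pos w_nonneg[OF \<xi>] in \<open>auto simp: norm_mult abs_mult\<close>)
  have w1: "w 0 \<xi> \<le> 1" using w_le_b[OF \<xi>, of 0] by (simp add: b_0)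
  have "of_real c * cis (x \<bullet> \<xi>) - P x \<xi> = of_real (c * (1 - w 0 \<xi>)) * cis (x \<bullet> \<xi>) - (P x \<xi> + - ?u 0)"
    by (simp add: lat_simps algebra_simps)
  also have "norm \<dots> \<le> norm (of_real (c * (1 - w 0 \<xi>)) * cis (x \<bullet> \<xi>)) + norm (P x \<xi> + - ?u 0)"
    by (rule norm_triangle_ineq4)
  also have "norm (of_real (c * (1 - w 0 \<xi>)) * cis (x \<bullet> \<xi>)) = c * (1 - w 0 \<xi>)"
    using c_pos w1 by (simp add: norm_mult abs_mult del: of_real_mult of_real_diff)
  finally show ?thesis using a by simp
qed

text \<open>Sampling an inverse transform uses the exponential with positive sign, so the sample at
  \<open>j\<close> is the coefficient at \<open>- j\<close>, as the pairing in Parseval's identity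
  wants it.\<close>

lemma Jterm_eq:
  fixes F :: "real ^ 'n \<Rightarrow> complex"
  shows "Jterm \<Phi> F x (j, k) =
    of_real (c * c) * cis (2 * pi * (x \<bullet> lat k)) * (coef (\<lambda>\<xi>. F (\<xi> + per k)) (- j) * coef (P x) j)"
proof -
  have "(LINT \<xi>|lebesgue. F (\<xi> + per k) * indicator cube \<xi> * exp (\<i> * of_real (lat j \<bullet> \<xi>))) =
    (LINT \<xi>|lebesgue. indicator cube \<xi> *\<^sub>R (F (\<xi> + per k) * cis (- (lat (- j) \<bullet> \<xi>))))"
    by (intro Bochner_Integration.integral_cong) (auto simp: lat_simps cis_conv_exp indicator_def)
  also have "\<dots> = coef (\<lambda>\<xi>. F (\<xi> + per k)) (- j)"
    unfolding coef_def by (simp add: integral_restrict_space)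
  finally have "band F k (lat j) = of_real c * coef (\<lambda>\<xi>. F (\<xi> + per k)) (- j)"
    unfolding band_def fourier_inv_def c_def by simp
  then show ?thesis
    unfolding Jterm_def Lfun_eq_coef by (simp add: cis_conv_exp mult_ac)
qed

section \<open>Approximand and error for a fixed function of the space\<close>

context
  fixes F :: "real ^ 'n \<Rightarrow> complex" and s :: "int ^ 'n \<Rightarrow> real"
  assumes F: "F \<in> borel_measurable lebesgue"
    and Fs: "\<And>k. AE \<xi> in cubeM. norm (F (\<xi> + per k)) \<le> s k"
    and s: "s summable_on UNIV" and s0: "\<And>k. 0 \<le> s k"
begin

lemma ebdd_F: "ebdd (\<lambda>\<xi>. F (\<xi> + per k))"
proof (rule ebddI[OF _ Fs])
  have "(\<lambda>\<xi>. F (\<xi> + per k)) \<in> borel_measurable lebesgue"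
    using lebesgue_integral_translation(3)[OF F, of "per k"] by (simp add: add.commute)
  then show "(\<lambda>\<xi>. F (\<xi> + per k)) \<in> borel_measurable cubeM" by (rule measurable_restrict_space1)
qed

text \<open>The bound is linear in \<open>s k\<close>, so it is summable over
  \<open>k\<close>.\<close>

lemma energy_F: "sqrt (energy (\<lambda>\<xi>. F (\<xi> + per k))) \<le> sqrt ((2 * pi) ^ CARD('n)) * s k"
proof -
  interpret finite_measure "cubeM :: (real^'n) measure" by (rule finite_measure_cube)
  have "integrable cubeM (\<lambda>\<xi>. norm (F (\<xi> + per k) * F (\<xi> + per k)))"
    by (intro integrable_norm ebdd_integrable ebdd_mult ebdd_F)
  then have i: "integrable cubeM (\<lambda>\<xi>. (norm (F (\<xi> + per k)))\<^sup>2)" by (simp add: norm_mult power2_eq_square)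
  have "energy (\<lambda>\<xi>. F (\<xi> + per k)) \<le> (LINT \<xi>|(cubeM :: (real^'n) measure). (s k)\<^sup>2)"
    unfolding energy_def
  proof (rule integral_mono_AE[OF i])
    show "AE \<xi> in cubeM. (norm (F (\<xi> + per k)))\<^sup>2 \<le> (s k)\<^sup>2"
      using Fs[of k] by eventually_elim (simp add: power_mono)
  qed simp
  also have "\<dots> = (2 * pi) ^ CARD('n) * (s k)\<^sup>2" by (simp add: measure_restrict_space measure_lebesgue_cube)
  finally have "sqrt (energy (\<lambda>\<xi>. F (\<xi> + per k))) \<le> sqrt ((2 * pi) ^ CARD('n) * (s k)\<^sup>2)" by (rule real_sqrt_le_mono)
  then show ?thesis using s0[of k] by (simp only: real_sqrt_mult real_sqrt_abs abs_of_nonneg)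
qed

text \<open>The pair is swapped to put \<open>k\<close> outside: for fixed \<open>k\<close> the sum
  over \<open>j\<close> is controlled by the two energies, hence by a constant times
  \<open>s k\<close>.\<close>

lemma Jterm_swap_abs_summable: "(\<lambda>p. norm (case p of (k, j) \<Rightarrow> Jterm \<Phi> F x (j, k))) summable_on (UNIV \<times> UNIV)"
proof -
  define W :: real where "W = (2 * pi) ^ CARD('n)"
  have n: "norm (Jterm \<Phi> F x (j, k)) = c * c * norm (coef (\<lambda>\<xi>. F (\<xi> + per k)) (- j) * coef (P x) j)" for j k
    unfolding Jterm_eq using c_pos by (simp add: norm_mult abs_mult)
  have in1: "(\<lambda>j. norm (Jterm \<Phi> F x (j, k))) summable_on UNIV" for k
    unfolding n by (intro summable_on_cmult_right coef_product_abs_summable(1) ebdd_F ebdd_P)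
  have in2: "(\<Sum>\<^sub>\<infinity>j. norm (Jterm \<Phi> F x (j, k))) \<le> c * c * W * sqrt W * sqrt (energy (P x)) * s k" for k
  proof -
    have "(\<Sum>\<^sub>\<infinity>j. norm (Jterm \<Phi> F x (j, k))) \<le> c * c * (W * sqrt (energy (\<lambda>\<xi>. F (\<xi> + per k))) * sqrt (energy (P x)))"
      unfolding n W_def infsum_cmult_right'
      by (intro mult_left_mono coef_product_abs_summable(3) ebdd_F ebdd_P) simp
    also have "\<dots> \<le> c * c * (W * (sqrt W * s k) * sqrt (energy (P x)))"
      using energy_F[of k] energy_nonneg unfolding W_def by (intro mult_left_mono mult_right_mono) auto
    finally show ?thesis by (simp add: mult_ac)
  qed
  have "(\<lambda>k. norm (\<Sum>\<^sub>\<infinity>j. norm (Jterm \<Phi> F x (j, k)))) summable_on UNIV"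
    by (rule summable_on_comparison_test[OF summable_on_cmult_right[OF s]])
      (use in2 in \<open>auto simp: infsum_nonneg abs_of_nonneg\<close>)
  with in1 show ?thesis unfolding Infinite_Sum.abs_summable_on_Sigma_iff by simp
qed

lemma Jterm_summable: "Jterm \<Phi> F x summable_on UNIV"
  using abs_summable_summable[OF Jterm_swap_abs_summable] summable_on_swap[of "Jterm \<Phi> F x" UNIV UNIV] by simp

lemma J_has_sum:
  "((\<lambda>k. cis (2 * pi * (x \<bullet> lat k)) * (LINT \<xi>|cubeM. F (\<xi> + per k) * P x \<xi>)) has_sum J \<Phi> F x) UNIV"
proof -
  have "((\<lambda>(k, j). Jterm \<Phi> F x (j, k)) has_sum J \<Phi> F x) (UNIV \<times> UNIV)"
    unfolding J_def
    by (rule has_sum_swap[where f="Jterm \<Phi> F x" and A=UNIV and B=UNIV, THEN iffD1])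
      (simp only: UNIV_Times_UNIV has_sum_infsum[OF Jterm_summable])
  then show ?thesis
  proof (rule has_sum_SigmaD)
    fix k :: "int ^ 'n"
    let ?I = "LINT \<xi>|cubeM. F (\<xi> + per k) * P x \<xi>"
    have "((\<lambda>j. of_real (c * c) * cis (2 * pi * (x \<bullet> lat k)) * (coef (\<lambda>\<xi>. F (\<xi> + per k)) (- j) * coef (P x) j)) has_sum
      of_real (c * c) * cis (2 * pi * (x \<bullet> lat k)) * (of_real ((2 * pi) ^ CARD('n)) * ?I)) UNIV"
      by (intro has_sum_cmult_right parseval ebdd_F ebdd_P)
    also have "of_real (c * c) * cis (2 * pi * (x \<bullet> lat k)) * (of_real ((2 * pi) ^ CARD('n)) * ?I) =
      of_real (c * c * (2 * pi) ^ CARD('n)) * (cis (2 * pi * (x \<bullet> lat k)) * ?I)"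
      by (simp only: of_real_mult mult_ac)
    finally show "((\<lambda>j. case (k, j) of (k, j) \<Rightarrow> Jterm \<Phi> F x (j, k)) has_sum cis (2 * pi * (x \<bullet> lat k)) * ?I) UNIV"
      unfolding c_sq by (simp add: Jterm_eq)
  qed
qed

lemma fourier_inv_has_sum:
  "((\<lambda>k. cis (2 * pi * (x \<bullet> lat k)) * (LINT \<xi>|cubeM. F (\<xi> + per k) * (of_real c * cis (x \<bullet> \<xi>)))) has_sum fourier_inv F x) UNIV"
proof -
  define G where "G \<xi> = F \<xi> * cis (x \<bullet> \<xi>)" for \<xi>
  have Gm: "G \<in> borel_measurable lebesgue"
    unfolding G_def using F cis_measurable[of x 0] by simp
  have Gb: "AE \<xi> in cubeM. norm (G (\<xi> + per k)) \<le> s k" for k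
    using Fs[of k] by (simp add: G_def norm_mult)
  have "((\<lambda>k. of_real c * (LINT \<xi>|cubeM. G (\<xi> + per k))) has_sum of_real c * (LINT \<xi>|lebesgue. G \<xi>)) UNIV"
    by (intro has_sum_cmult_right tile_integral(2)[OF Gm Gb s])
  also have "of_real c * (LINT \<xi>|lebesgue. G \<xi>) = fourier_inv F x"
    unfolding fourier_inv_def c_def G_def cis_conv_exp by simp
  also have "(\<lambda>k. of_real c * (LINT \<xi>|cubeM. G (\<xi> + per k))) =
    (\<lambda>k. cis (2 * pi * (x \<bullet> lat k)) * (LINT \<xi>|cubeM. F (\<xi> + per k) * (of_real c * cis (x \<bullet> \<xi>))))"
    unfolding integral_mult_right_zero[symmetric]
  proof (rule ext, rule Bochner_Integration.integral_cong)
    fix k :: "int ^ 'n" and \<xi> :: "real ^ 'n"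
    show "of_real c * G (\<xi> + per k) = cis (2 * pi * (x \<bullet> lat k)) * (F (\<xi> + per k) * (of_real c * cis (x \<bullet> \<xi>)))"
      unfolding G_def inner_add_right inner_scaleR_right cis_mult[symmetric] by (simp only: mult_ac)
  qed simp
  finally show ?thesis .
qed

lemma integrable_w0: "integrable cubeM (\<lambda>\<xi>. 1 - w 0 \<xi>)"
proof -
  interpret finite_measure "cubeM :: (real^'n) measure" by (rule finite_measure_cube)
  have "AE \<xi> in cubeM. norm (w 0 \<xi>) \<le> b 0"
    using AE_punctured_cube by eventually_elim (use w_le_b w_nonneg in auto)
  then have "integrable cubeM (w 0)" by (intro integrable_const_bound measurable_restrict_space1 w_measurable)
  then show ?thesis by simp
qed

text \<open>Both sums run over \<open>k\<close> with the same modulation, so they are subtracted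
  term by term. The majorant does not contain \<open>x\<close>, which is the source of
  uniformity.\<close>

lemma J_error:
  "norm (fourier_inv F x - J \<Phi> F x) \<le> infsum s UNIV * (2 * c * (LINT \<xi>|cubeM. 1 - w 0 \<xi>))"
proof (rule norm_infsum_le[OF has_sum_add[OF fourier_inv_has_sum has_sum_uminusI[OF J_has_sum], of x x, simplified] has_sum_cmult_left[OF has_sum_infsum[OF s]]])
  fix k :: "int ^ 'n"
  let ?E = "\<lambda>\<xi>. F (\<xi> + per k) * (of_real c * cis (x \<bullet> \<xi>) - P x \<xi>)"
  have e: "ebdd ?E" by (intro ebdd_mult ebdd_diff ebdd_F ebdd_cmult ebdd_cis ebdd_P)
  have "(LINT \<xi>|cubeM. F (\<xi> + per k) * (of_real c * cis (x \<bullet> \<xi>))) - (LINT \<xi>|cubeM. F (\<xi> + per k) * P x \<xi>) = (LINT \<xi>|cubeM. ?E \<xi>)"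
    unfolding right_diff_distrib
    by (intro Bochner_Integration.integral_diff[symmetric] ebdd_integrable ebdd_mult ebdd_F ebdd_cmult ebdd_cis ebdd_P)
  note h = this
  have "cis (2 * pi * (x \<bullet> lat k)) * (LINT \<xi>|cubeM. F (\<xi> + per k) * (of_real c * cis (x \<bullet> \<xi>)))
     - cis (2 * pi * (x \<bullet> lat k)) * (LINT \<xi>|cubeM. F (\<xi> + per k) * P x \<xi>) = cis (2 * pi * (x \<bullet> lat k)) * (LINT \<xi>|cubeM. ?E \<xi>)"
    by (subst h[symmetric]) (rule right_diff_distrib[symmetric])
  moreover have "norm (LINT \<xi>|cubeM. ?E \<xi>) \<le> (LINT \<xi>|cubeM. norm (?E \<xi>))" by (rule integral_norm_bound)
  moreover have "(LINT \<xi>|cubeM. norm (?E \<xi>)) \<le> (LINT \<xi>|cubeM. s k * (2 * c * (1 - w 0 \<xi>)))"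
  proof (rule integral_mono_AE)
    show "integrable cubeM (\<lambda>\<xi>. norm (?E \<xi>))" by (intro integrable_norm ebdd_integrable e)
    show "integrable cubeM (\<lambda>\<xi>. s k * (2 * c * (1 - w 0 \<xi>)))" by (intro integrable_mult_right integrable_w0)
    show "AE \<xi> in cubeM. norm (?E \<xi>) \<le> s k * (2 * c * (1 - w 0 \<xi>))"
      using AE_punctured_cube Fs[of k]
    proof eventually_elim
      case (elim \<xi>)
      show ?case unfolding norm_mult by (rule mult_mono[OF elim(2) P_error[OF elim(1)] s0 norm_ge_zero])
    qed
  qed
  moreover have "(LINT \<xi>|cubeM. s k * (2 * c * (1 - w 0 \<xi>))) = s k * (2 * c * (LINT \<xi>|cubeM. 1 - w 0 \<xi>))"
    by (simp only: integral_mult_right_zero)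
  ultimately show "norm (cis (2 * pi * (x \<bullet> lat k)) * (LINT \<xi>|cubeM. F (\<xi> + per k) * (of_real c * cis (x \<bullet> \<xi>)))
     - cis (2 * pi * (x \<bullet> lat k)) * (LINT \<xi>|cubeM. F (\<xi> + per k) * P x \<xi>)) \<le> s k * (2 * c * (LINT \<xi>|cubeM. 1 - w 0 \<xi>))"
    by (simp only: norm_mult norm_cis mult_1_left)
qed

end

end

section \<open>Convergence along the family\<close>

lemma symbolI:
  fixes \<Phi> :: "real ^ 'n \<Rightarrow> real"
  assumes ci: "cardinal_interpolator \<phi> \<Phi>"
    and M: "(\<lambda>j. \<bar>M j\<bar>) summable_on (- {0})"
    and Mr: "\<And>j \<xi>. j \<noteq> 0 \<Longrightarrow> \<xi> \<in> cube - {0} \<Longrightarrow> Mratio \<Phi> j \<xi> \<le> M j"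
  shows "symbol \<Phi> (\<lambda>j. if j = 0 then 1 else \<bar>M j\<bar>)"
proof
  show "0 \<le> \<Phi> \<xi>" if "\<xi> \<noteq> 0" for \<xi> using ci that by (simp add: cardinal_interpolator_def)
  show "0 < \<Phi> \<xi>" if "\<xi> \<in> cube - {0}" for \<xi>
    using ci that unfolding cardinal_interpolator_def by (meson less_le_trans)
  \<comment> \<open>The order n + 1 is a successor, so \<open>C_on\<close> contains
    differentiability at every nonzero point, and with it continuity.\<close>
  have "C_on (Suc CARD('n)) (- {0}) \<Phi>" using ci by (simp add: cardinal_interpolator_def)
  then show "continuous_on (- {0}) \<Phi>"
    by (auto intro!: continuous_at_imp_continuous_on differentiable_imp_continuous_within)
  have "(\<lambda>j. if j = 0 then 1 else \<bar>M j\<bar>) summable_on (- {0})"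
    using M by (rule summable_on_cong[THEN iffD1, rotated]) auto
  then have "(\<lambda>j. if j = 0 then 1 else \<bar>M j\<bar>) summable_on insert 0 (- {0})"
    by (subst summable_on_insert_iff)
  then show "(\<lambda>j. if j = 0 then 1 else \<bar>M j\<bar>) summable_on UNIV"
    by (simp only: Compl_partition insert_is_Un[of 0 "- {0}"])
  show "Mratio \<Phi> m \<xi> \<le> (if m = 0 then 1 else \<bar>M m\<bar>)" if "m \<noteq> 0" "\<xi> \<in> cube - {0}" for m \<xi>
    using Mr[OF that] that by (simp add: abs_le_iff le_max_iff_disj order_trans[OF _ abs_ge_self])
qed auto

text \<open>The filter has a countable base: if the limit failed, one could pick points of
  \<open>A\<close> beyond every integer at which \<open>d\<close> avoids a fixed neighbourhood of
  \<open>L\<close>.\<close>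

lemma tendsto_along:
  fixes d :: "real \<Rightarrow> real"
  assumes d: "\<And>X. (\<And>i. X i \<in> A) \<Longrightarrow> filterlim X at_top sequentially \<Longrightarrow> (\<lambda>i::nat. d (X i)) \<longlonglongrightarrow> L"
  shows "(d \<longlongrightarrow> L) (along A)"
proof (rule topological_tendstoI)
  fix U assume U: "open U" "L \<in> U"
  show "eventually (\<lambda>\<alpha>. d \<alpha> \<in> U) (along A)"
  proof (rule ccontr)
    assume "\<not> ?thesis"
    then have "\<And>N. \<exists>\<alpha>\<ge>N. \<alpha> \<in> A \<and> d \<alpha> \<notin> U"
      unfolding along_def eventually_inf_principal eventually_at_top_linorder by blast
    then have "\<forall>i::nat. \<exists>\<alpha>. real i \<le> \<alpha> \<and> \<alpha> \<in> A \<and> d \<alpha> \<notin> U" by blast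
    then obtain X where X: "\<And>i::nat. real i \<le> X i" "\<And>i. X i \<in> A" "\<And>i. d (X i) \<notin> U" by metis
    have "filterlim X at_top sequentially"
      by (rule filterlim_at_top_mono[OF filterlim_real_sequentially]) (simp add: X(1))
    from topological_tendstoD[OF d[OF X(2) this] U] X(3) show False by simp
  qed
qed

lemma filterlim_along:
  "(\<And>i. X i \<in> A) \<Longrightarrow> filterlim X at_top F \<Longrightarrow> filterlim X (along A) F"
  by (simp add: along_def filterlim_inf filterlim_principal)

text \<open>The integrand is the sum of the weights with m \<noteq> 0. Tannery's theorem with
  majorant \<open>b\<close> sends it to 0 almost everywhere, and the constant 1 dominates it on the
  cube.\<close>

lemma tendsto_integral_one_minus_w:
  fixes \<Phi> :: "nat \<Rightarrow> real ^ 'n \<Rightarrow> real"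
  assumes sym: "\<And>i. symbol (\<Phi> i) b"
    and lim: "\<And>m. m \<noteq> 0 \<Longrightarrow> AE \<xi> in cubeM. (\<lambda>i. Mratio (\<Phi> i) m \<xi>) \<longlonglongrightarrow> 0"
  shows "(\<lambda>i. LINT \<xi>|cubeM. 1 - symbol.w (\<Phi> i) 0 \<xi>) \<longlonglongrightarrow> 0"
proof -
  interpret finite_measure "cubeM :: (real^'n) measure" by (rule finite_measure_cube)
  define e :: "nat \<Rightarrow> int ^ 'n" where "e = from_nat_into UNIV"
  have e: "bij_betw e UNIV UNIV"
    unfolding e_def using infinite_int_vec by (intro bij_betw_from_nat_into) auto
  have b: "summable (\<lambda>n. b (e n))"
    using summable_on_reindex_bij_betw[OF e, of b] symbol.b_summable[OF sym] by (auto intro: summable_on_imp_summable)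
  \<comment> \<open>Countability of the lattice merges the exceptional null sets of the single
    indices into one.\<close>
  have "AE \<xi> in cubeM. \<forall>m. m \<noteq> 0 \<longrightarrow> (\<lambda>i. Mratio (\<Phi> i) m \<xi>) \<longlonglongrightarrow> 0"
    using lim by (simp add: AE_all_countable)
  then have pt: "AE \<xi> in cubeM. (\<lambda>i. 1 - symbol.w (\<Phi> i) 0 \<xi>) \<longlonglongrightarrow> 0"
    using AE_punctured_cube
  proof eventually_elim
    case (elim \<xi>)
    define a where "a k i = (if e k = 0 then 0 else symbol.w (\<Phi> i) (e k) \<xi>)" for k i
    have a: "(\<lambda>i. a k i) \<longlonglongrightarrow> 0" for k
    proof (cases "e k = 0")
      case False
      show ?thesis
      proof (rule tendsto_sandwich[OF _ _ tendsto_const])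
        show "(\<lambda>i. Mratio (\<Phi> i) (e k) \<xi>) \<longlonglongrightarrow> 0" using elim(1) False by blast
      qed (use symbol.w_le_Mratio[OF sym elim(2)] symbol.w_nonneg[OF sym elim(2)] False in \<open>auto simp: a_def\<close>)
    qed (simp add: a_def)
    have ab: "norm (a k i) \<le> b (e k)" for k i
      using symbol.w_le_b[OF sym elim(2), of i "e k"] symbol.w_nonneg[OF sym elim(2), of i "e k"] symbol.b_nonneg[OF sym]
      by (auto simp: a_def)
    have "(\<lambda>i. \<Sum>k. a k i) \<longlonglongrightarrow> (\<Sum>k::nat. 0)"
      using tannerys_theorem[OF a _ b] ab by (simp add: case_prod_unfold)
    moreover have "(\<Sum>k. a k i) = 1 - symbol.w (\<Phi> i) 0 \<xi>" for i
    proof -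
      let ?w = "symbol.w (\<Phi> i)"
      have "((\<lambda>m. if m = 0 then ?w 0 \<xi> else 0) has_sum ?w 0 \<xi>) UNIV"
        by (rule has_sum_finite_neutralI[of "{0}"]) auto
      then have "((\<lambda>m. ?w m \<xi> + - (if m = 0 then ?w 0 \<xi> else 0)) has_sum 1 + - ?w 0 \<xi>) UNIV"
        by (intro has_sum_add has_sum_uminusI symbol.w_has_sum[OF sym elim(2)])
      then have "((\<lambda>k. ?w (e k) \<xi> + - (if e k = 0 then ?w 0 \<xi> else 0)) has_sum 1 + - ?w 0 \<xi>) UNIV"
        by (subst has_sum_reindex_bij_betw[OF e])
      also have "(\<lambda>k. ?w (e k) \<xi> + - (if e k = 0 then ?w 0 \<xi> else 0)) = (\<lambda>k. a k i)" by (auto simp: a_def)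
      finally show ?thesis by (simp add: has_sum_imp_sums sums_unique[symmetric])
    qed
    ultimately show ?case by simp
  qed
  have "(\<lambda>i. LINT \<xi>|cubeM. 1 - symbol.w (\<Phi> i) 0 \<xi>) \<longlonglongrightarrow> (LINT \<xi>|(cubeM :: (real^'n) measure). 0)"
  proof (rule integral_dominated_convergence[where w="\<lambda>_. 1", OF _ _ _ pt])
    show "(\<lambda>\<xi>. 1 - symbol.w (\<Phi> i) 0 \<xi>) \<in> borel_measurable cubeM" for i
      using symbol.w_measurable[OF sym] by (intro measurable_restrict_space1) simp
    show "AE \<xi> in cubeM. norm (1 - symbol.w (\<Phi> i) 0 \<xi>) \<le> 1" for i
      using AE_punctured_cube
    proof eventually_elim
      case (elim \<xi>)
      show ?case
        using symbol.w_le_b[OF sym elim, of i 0] symbol.w_nonneg[OF sym elim, of i 0] symbol.b_0[OF sym] by simp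
    qed
  qed auto
  then show ?thesis by simp
qed

theorem corollary1:
  fixes A :: "real set"
    and \<phi> \<phi>hat :: "real \<Rightarrow> real ^ 'n \<Rightarrow> real"
    and f fhat :: "real ^ 'n \<Rightarrow> complex"
  assumes "regular_family A \<phi> \<phi>hat"
    and "FW f fhat"
  shows "(\<forall>\<alpha>\<in>A. \<forall>x. Jterm (\<phi>hat \<alpha>) fhat x summable_on UNIV) \<and>
         uniform_limit UNIV (\<lambda>\<alpha> x. cmod (f x - J (\<phi>hat \<alpha>) fhat x)) (\<lambda>x. 0) (along A)"
proof -
  obtain M :: "int ^ 'n \<Rightarrow> real" where M: "(\<lambda>j. \<bar>M j\<bar>) summable_on (- {0})"
    and Mr: "\<And>j \<alpha> \<xi>. j \<noteq> 0 \<Longrightarrow> \<alpha> \<in> A \<Longrightarrow> \<xi> \<in> cube - {0} \<Longrightarrow> Mratio (\<phi>hat \<alpha>) j \<xi> \<le> M j"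
  proof -
    have "\<exists>M :: int ^ 'n \<Rightarrow> real. (\<lambda>j. \<bar>M j\<bar>) summable_on (- {0}) \<and>
      (\<forall>j. j \<noteq> 0 \<longrightarrow> (\<forall>\<alpha>\<in>A. \<forall>\<xi>\<in>cube - {0}. Mratio (\<phi>hat \<alpha>) j \<xi> \<le> M j))"
      using assms(1) unfolding regular_family_def by (elim conjE)
    then show ?thesis using that by blast
  qed
  \<comment> \<open>The bound in (R2) is uniform in \<alpha>, so one majorant serves the whole
    family.\<close>
  define b where "b j = (if j = 0 then 1 else \<bar>M j\<bar>)" for j
  have sym: "symbol (\<phi>hat \<alpha>) b" if "\<alpha> \<in> A" for \<alpha>
    unfolding b_def
    by (rule symbolI[OF _ M Mr[OF _ that]]) (use assms(1) that in \<open>auto simp: regular_family_def\<close>)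
  define E where "E k = esssup cubeM (\<lambda>\<xi>. ennreal (norm (fhat (\<xi> + per k))))" for k
  define s where "s k = enn2real (E k)" for k
  have Efin: "infsum E UNIV < \<infinity>" using assms(2) unfolding FW_def E_def[abs_def] by blast
  \<comment> \<open>Every family in \<open>ennreal\<close> has a sum that dominates its finite
    partial sums. This yields finiteness of each \<open>E k\<close> and, after passing to reals,
    summability of \<open>s\<close>.\<close>
  have Esum: "sum E S \<le> infsum E UNIV" if "finite S" for S
    by (rule has_sum_mono'[OF has_sum_finite[OF that] has_sum_infsum[OF nonneg_summable_on_complete]]) auto
  have Ek: "E k < top" for k using Esum[of "{k}"] Efin by (simp add: order_le_less_trans)
  have ss: "s summable_on UNIV"
  proof (rule nonneg_bdd_above_summable_on)
    show "bdd_above (sum s ` {S. S \<subseteq> UNIV \<and> finite S})"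
    proof (rule bdd_aboveI)
      fix y assume "y \<in> sum s ` {S. S \<subseteq> UNIV \<and> finite S}"
      then obtain S where S: "finite S" "y = sum s S" by auto
      have "y = enn2real (sum E S)" unfolding S(2) s_def
        using Ek by (simp add: enn2real_sum comp_def)
      also have "\<dots> \<le> enn2real (infsum E UNIV)"
        using Esum[OF S(1)] Efin by (intro enn2real_mono) auto
      finally show "y \<le> enn2real (infsum E UNIV)" .
    qed
  qed (simp add: s_def)
  have Fs: "AE \<xi> in cubeM. norm (fhat (\<xi> + per k)) \<le> s k" for k
    using esssup_AE[of "\<lambda>\<xi>. ennreal (norm (fhat (\<xi> + per k)))" cubeM]
  proof eventually_elim
    case (elim \<xi>)
    then have "ennreal (norm (fhat (\<xi> + per k))) \<le> ennreal (s k)" using Ek[of k] by (simp add: E_def s_def)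
    then show ?case by (simp add: s_def)
  qed
  have Fm: "fhat \<in> borel_measurable lebesgue" using assms(2) by (simp add: FW_def Linf_def)
  have s0: "0 \<le> s k" for k by (simp add: s_def)
  \<comment> \<open>Integrability of \<open>fhat\<close>, which inversion requires, comes from
    tiling with the summable bounds \<open>s\<close>.\<close>
  have "f x = fourier_inv fhat x" for x
    using assms(2) tile_integral(1)[OF Fm Fs ss] unfolding FW_def by (intro fourier_inversion) auto
  \<comment> \<open>\<open>symbol.c\<close> depends on the dimension alone, so \<open>K\<close> is
    the same for all \<alpha> and x.\<close>
  define K where "K = infsum s UNIV * (2 * (2 * pi) powr (- real CARD('n) / 2))"
  define d where "d \<alpha> = (LINT \<xi>|cubeM. 1 - symbol.w (\<phi>hat \<alpha>) 0 \<xi>)" for \<alpha>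
  have err: "norm (f x - J (\<phi>hat \<alpha>) fhat x) \<le> K * d \<alpha>" if "\<alpha> \<in> A" for \<alpha> x
    using symbol.J_error[OF sym[OF that] Fm Fs ss s0, of x] unfolding symbol.c_def[OF sym[OF that]]
    by (simp add: \<open>f x = fourier_inv fhat x\<close> K_def d_def mult.assoc)
  have "(d \<longlongrightarrow> 0) (along A)"
  proof (rule tendsto_along)
    fix X :: "nat \<Rightarrow> real" assume X: "\<And>i. X i \<in> A" "filterlim X at_top sequentially"
    show "(\<lambda>i. d (X i)) \<longlonglongrightarrow> 0"
      unfolding d_def
    proof (rule tendsto_integral_one_minus_w[OF sym[OF X(1)]])
      fix m :: "int ^ 'n" assume "m \<noteq> 0"
      then have "AE \<xi> in cubeM. ((\<lambda>\<alpha>. Mratio (\<phi>hat \<alpha>) m \<xi>) \<longlongrightarrow> 0) (along A)"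
        using assms(1) by (simp add: regular_family_def)
      then show "AE \<xi> in cubeM. (\<lambda>i. Mratio (\<phi>hat (X i)) m \<xi>) \<longlonglongrightarrow> 0"
        by eventually_elim (rule filterlim_compose[OF _ filterlim_along[OF X]])
    qed
  qed
  then have Kd: "((\<lambda>\<alpha>. K * d \<alpha>) \<longlongrightarrow> K * 0) (along A)" by (intro tendsto_intros)
  have inA: "eventually (\<lambda>\<alpha>. \<alpha> \<in> A) (along A)" by (simp add: along_def eventually_inf_principal)
  have "uniform_limit UNIV (\<lambda>\<alpha> x. cmod (f x - J (\<phi>hat \<alpha>) fhat x)) (\<lambda>x. 0) (along A)"
  proof (rule uniform_limitI)
    fix e :: real assume "0 < e"
    then have "eventually (\<lambda>\<alpha>. K * d \<alpha> < e) (along A)" using Kd by (intro order_tendstoD(2)[of _ 0]) simp_all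
    then show "eventually (\<lambda>\<alpha>. \<forall>x\<in>UNIV. dist (cmod (f x - J (\<phi>hat \<alpha>) fhat x)) 0 < e) (along A)"
      using inA by eventually_elim (use err in \<open>auto intro: order_le_less_trans\<close>)
  qed
  moreover have "\<forall>\<alpha>\<in>A. \<forall>x. Jterm (\<phi>hat \<alpha>) fhat x summable_on UNIV"
    using symbol.Jterm_summable[OF sym Fm Fs ss s0] by blast
  ultimately show ?thesis by blast
qed

end
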